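(* Let $\mathcal H$ be an infinite dimensional complex Hilbert space, let $A$ be a bounded linear operator on $\mathcal H$, and suppose there are $\mu,\nu\in\mathbb C$ such that $A^2-2\mu A-\nu I=0$, where both eigenvalues $\lambda_{1,2}=\mu\pm\sqrt{\mu^2+\nu}$ of $A$ have infinite multiplicity. Suppose moreover that $$\|A-\mu I\|=\|A-\mu I\|_{\rm ess},$$ and denote this common value by $s$. Let $c=(c_1,\dots,c_k)$ be a $k$-tuple of non-zero real numbers, $\|c\|=\sum_{j=1}^k|c_j|$, let $m_+$ and $m_-$ be the numbers of positive and of negative entries among the $c_j$ respectively, and $m=\max\{m_+,m_-\}$. Let $E$ be the closed, and $E_0$ the open, elliptical disc with foci at $\mu\sum_{j=1}^k c_j\pm\sqrt{\mu^2+\nu}\,\|c\|$, with major axis of length $(s+|\mu^2+\nu|s^{-1})\|c\|$ and minor axis of length $(s-|\mu^2+\nu|s^{-1})\|c\|$. Then $W_c(A)=E$ if the norm of $A-\mu I$ is attained on a subspace of dimension at least $m$, and $W_c(A)=E_0$ otherwise.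
   Context: For a $k$-tuple $c=(c_1,\dots,c_k)$ of non-zero real numbers, the $c$-numerical range of $A$ is $W_c(A)=\{\sum_{j=1}^k c_j\langle Ax_j,x_j\rangle : \{x_j\}_{j=1}^k \text{ is an orthonormal subset of }\mathcal H\}$. The essential norm is $\|B\|_{\rm ess}=\inf\{\|B+K\| : K\text{ compact on }\mathcal H\}$. Eigenvalue $\lambda_j$ has infinite multiplicity if $\ker(A-\lambda_j I)$ is infinite dimensional (the case $\lambda_1=\lambda_2$ is allowed). The norm of an operator $B$ is attained on a subspace $L$ if $\|Bx\|=\|B\|\,\|x\|$ for all $x\in L$. Lengths of axes are full lengths (not semi-axes). Elliptical discs may be degenerate: when the minor axis has length $0$, the closed disc is the closed segment joining the foci and the open disc is that segment without its endpoints (relative interior); when both axes have length $0$, it is a single point. If $s=0$ (so that $\mu^2+\nu=0$), the expression $|\mu^2+\nu|s^{-1}$ is interpreted as $0$. *)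

theory Defs
  imports "HOL-Analysis.Analysis"
begin

section \<open>Complex Hilbert spaces\<close>

text \<open>
  The library only provides real inner product spaces. A complex inner product space is set up
  here as a real inner product space with a compatible complex structure; since the real inner
  product is the real part of the complex one, the norm of \<open>x\<close> is
  \<open>sqrt (Re (cinner x x))\<close>, and the library's norm, topology and notion of bounded linear map are the usual ones.
\<close>

class complex_vector = real_vector +
  fixes scaleC :: "complex \<Rightarrow> 'a \<Rightarrow> 'a" (infixr "*\<^sub>C" 75)
  assumes scaleC_add_right: "a *\<^sub>C (x + y) = a *\<^sub>C x + a *\<^sub>C y"
    and scaleC_add_left: "(a + b) *\<^sub>C x = a *\<^sub>C x + b *\<^sub>C x"
    and scaleC_scaleC: "a *\<^sub>C (b *\<^sub>C x) = (a * b) *\<^sub>C x"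
    and scaleC_one: "1 *\<^sub>C x = x"
    and scaleR_scaleC: "r *\<^sub>R x = complex_of_real r *\<^sub>C x"

global_interpretation complex_vector:
  vector_space "scaleC :: complex \<Rightarrow> 'a \<Rightarrow> 'a :: complex_vector"
  by unfold_locales (rule scaleC_add_right scaleC_add_left scaleC_scaleC scaleC_one)+

text \<open>The inner product is linear in its first argument.\<close>

class complex_inner = complex_vector + real_inner +
  fixes cinner :: "'a \<Rightarrow> 'a \<Rightarrow> complex"
  assumes cinner_commute: "cinner x y = cnj (cinner y x)"
    and cinner_add_left: "cinner (x + y) z = cinner x z + cinner y z"
    and cinner_scaleC_left: "cinner (a *\<^sub>C x) y = a * cinner x y"
    and inner_eq_Re_cinner: "inner x y = Re (cinner x y)"

class chilbert_space = complex_inner + complete_space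

instance chilbert_space \<subseteq> banach ..

lemma norm_eq_sqrt_cinner: "norm (x :: 'a :: complex_inner) = sqrt (Re (cinner x x))"
  by (simp add: norm_eq_sqrt_inner inner_eq_Re_cinner)


section \<open>Complex dimension\<close>

definition infinite_cdim :: "'a :: complex_vector set \<Rightarrow> bool" where
  "infinite_cdim S \<longleftrightarrow> \<not> (\<exists>B. finite B \<and> S \<subseteq> complex_vector.span B)"

text \<open>\<^const>\<open>complex_vector.dim\<close> is 0 on infinite dimensional subspaces.\<close>

definition cdim_at_least :: "nat \<Rightarrow> 'a :: complex_vector set \<Rightarrow> bool" where
  "cdim_at_least n S \<longleftrightarrow> infinite_cdim S \<or> n \<le> complex_vector.dim S"


section \<open>Operators\<close>

definition clinear :: "('a :: complex_vector \<Rightarrow> 'b :: complex_vector) \<Rightarrow> bool" where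
  "clinear f \<longleftrightarrow> Vector_Spaces.linear scaleC scaleC f"

definition bounded_clinear :: "('a :: complex_inner \<Rightarrow> 'b :: complex_inner) \<Rightarrow> bool" where
  "bounded_clinear f \<longleftrightarrow> clinear f \<and> bounded_linear f"

definition compact_operator :: "('a :: complex_inner \<Rightarrow> 'b :: complex_inner) \<Rightarrow> bool" where
  "compact_operator f \<longleftrightarrow> bounded_clinear f \<and> compact (closure (f ` cball 0 1))"

definition ess_norm :: "('a :: complex_inner \<Rightarrow> 'a) \<Rightarrow> real" where
  "ess_norm B = Inf {onorm (\<lambda>x. B x + K x) | K. compact_operator K}"

definition eigenspace :: "('a :: complex_vector \<Rightarrow> 'a) \<Rightarrow> complex \<Rightarrow> 'a set" where
  "eigenspace A l = {x. A x - l *\<^sub>C x = 0}"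

definition norm_attained_on :: "('a :: complex_inner \<Rightarrow> 'a) \<Rightarrow> 'a set \<Rightarrow> bool" where
  "norm_attained_on B L \<longleftrightarrow> (\<forall>x\<in>L. norm (B x) = onorm B * norm x)"

text \<open>A tuple \<open>c\<close> is a list; its entries are indexed from 0.\<close>

definition c_numerical_range :: "real list \<Rightarrow> ('a :: complex_inner \<Rightarrow> 'a) \<Rightarrow> complex set" where
  "c_numerical_range c A =
     {\<Sum>j<length c. complex_of_real (c ! j) * cinner (A (x j)) (x j) | x :: nat \<Rightarrow> 'a.
        \<forall>i<length c. \<forall>j<length c. cinner (x i) (x j) = (if i = j then 1 else 0)}"


section \<open>Elliptical discs\<close>

text \<open>
  Below, \<open>f\<close> and \<open>g\<close> are the foci, \<open>a\<close> and \<open>b\<close> the full lengths of the major and minor axis.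
  These data are redundant: \<open>ellipse_data\<close> says that an ellipse with them exists, and the discs
  are only meaningful when it holds. In that case \<open>b = 0\<close> means \<open>a = dist f g\<close>, and
  \<open>a = b = 0\<close> means in addition \<open>f = g\<close>, so that the closed segment is then a point.
\<close>

definition ellipse_data :: "complex \<Rightarrow> complex \<Rightarrow> real \<Rightarrow> real \<Rightarrow> bool" where
  "ellipse_data f g a b \<longleftrightarrow> 0 \<le> a \<and> 0 \<le> b \<and> a\<^sup>2 = b\<^sup>2 + (dist f g)\<^sup>2"

definition closed_elliptical_disc :: "complex \<Rightarrow> complex \<Rightarrow> real \<Rightarrow> real \<Rightarrow> complex set" where
  "closed_elliptical_disc f g a b =
     (if b = 0 then closed_segment f g else {z. dist z f + dist z g \<le> a})"

definition open_elliptical_disc :: "complex \<Rightarrow> complex \<Rightarrow> real \<Rightarrow> real \<Rightarrow> complex set" where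
  "open_elliptical_disc f g a b =
     (if a = 0 \<and> b = 0 then {f}
      else if b = 0 then open_segment f g
      else {z. dist z f + dist z g < a})"

end

theory Submission imports Defs begin

text \<open>
  Put \<open>B = A - \<mu>I\<close> and \<open>\<sigma>\<^sup>2 = \<mu>\<^sup>2 + \<nu>\<close>, so that \<open>B\<^sup>2 = \<sigma>\<^sup>2 I\<close> and \<open>W\<^sub>c(A)\<close> is
  \<open>W\<^sub>c(B)\<close> translated by \<open>\<mu> \<Sum>c\<^sub>j\<close>.

  Translated to the origin and divided by \<open>\<parallel>c\<parallel>\<close>, the disc bounded by the ellipse is the image of the unit disc
  under the real-linear map
  \<open>T \<zeta> = (s \<zeta>\<^bsup>*\<^esup> + (\<sigma>\<^sup>2/s) \<zeta>) / 2\<close>, where \<open>\<zeta>\<^bsup>*\<^esup>\<close> is the conjugate of \<open>\<zeta>\<close>. On the unit circle both focal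
  distances are halves of squares of moduli, and the parallelogram law gives their sum
  (\<open>focal_sum_ellipse_boundary\<close>); convexity settles the other radii.

  Upper bound. If \<open>x\<close> is a unit vector and \<open>\<langle>Bx, x\<rangle> = T \<zeta>\<close>, then for every \<open>\<omega>\<close> of modulus \<open>1\<close> the vector
  \<open>v = x + (\<omega>\<^bsup>*\<^esup>/s) Bx\<close> satisfies
  \<open>s\<^sup>2 \<parallel>v\<parallel>\<^sup>2 - \<parallel>Bv\<parallel>\<^sup>2 = (s\<^sup>2 - \<bar>\<sigma>\<^sup>2/s\<bar>\<^sup>2) (1 + Re (\<omega> \<zeta>))\<close>
  (\<open>defect_identity\<close>). The left side is nonnegative, so \<open>\<bar>\<zeta>\<bar> \<le> 1\<close>, and \<open>Re (\<omega> \<zeta>) = -1\<close> happens only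
  if \<open>B\<close> attains its norm at \<open>v\<close>. A value of \<open>W\<^sub>c(B)\<close> on the boundary forces this for every vector of
  the orthonormal family, with one common \<open>\<omega>\<close> for the positive entries of \<open>c\<close> and with \<open>-\<omega>\<close> for the
  negative ones. As \<open>x \<mapsto> v\<close> is linear and injective when \<open>\<bar>\<sigma>\<bar> < s\<close>, the norm is then attained on a
  space of dimension \<open>m\<close> (\<open>c_numerical_range_upper\<close>).

  Lower bound. Suppose there are \<open>m\<close> mutually orthogonal orthonormal pairs \<open>(x, y)\<close> with \<open>Bx = t y\<close> and
  \<open>By = (\<sigma>\<^sup>2/t) x\<close>. In the plane of a pair, a point \<open>p\<close> of the ellipse belonging to \<open>t\<close> is the value at a unit
  vector \<open>z\<close>, and \<open>-p\<close> is the value at the unit vector orthogonal to \<open>z\<close>, because the trace vanishes.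
  Using \<open>z\<close> for positive and its companion for negative entries of \<open>c\<close> produces \<open>\<parallel>c\<parallel> p\<close>, so \<open>m\<close> planes
  suffice (\<open>c_numerical_range_exchanged_pairs\<close>). If \<open>B\<close> attains its norm on an \<open>m\<close>-dimensional space,
  an orthonormal family there and its image form such pairs with \<open>t = s\<close>. Otherwise the essential norm
  yields, orthogonally to any finite set, vectors \<open>x\<close> with \<open>\<parallel>Bx\<parallel>\<close> close to \<open>s\<close>; maximising \<open>\<parallel>Bv\<parallel>/\<parallel>v\<parallel>\<close> over
  the \<open>B\<close>-invariant plane of \<open>x\<close> and \<open>Bx\<close> gives pairs with \<open>t\<close> arbitrarily close to \<open>s\<close>, and hence
  every point of the open disc.

  If \<open>\<bar>\<sigma>\<bar> = s\<close>, then \<open>B\<close> is a scalar multiple of a self-adjoint unitary (or zero); its norm is attained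
  everywhere and the ellipse degenerates to a segment. Orthonormal families in the two infinite dimensional
  eigenspaces supply the pairs when \<open>s \<noteq> 0\<close>.
\<close>

section \<open>Complex inner products and orthonormal families\<close>

lemma cinner_add_right: "cinner x (y + z) = cinner x y + cinner x (z :: 'a :: complex_inner)"
  by (metis cinner_add_left cinner_commute complex_cnj_add)

lemma cinner_scaleC_right: "cinner x (a *\<^sub>C y) = cnj a * cinner x (y :: 'a :: complex_inner)"
  by (metis cinner_commute cinner_scaleC_left complex_cnj_mult)

lemma cinner_zero_left [simp]: "cinner 0 (y :: 'a :: complex_inner) = 0"
  using cinner_add_left[of 0 0 y] by simp

lemma cinner_zero_right [simp]: "cinner y (0 :: 'a :: complex_inner) = 0"
  using cinner_add_right[of y 0 0] by simp

lemma cinner_diff_left: "cinner (x - y) z = cinner x z - cinner y (z :: 'a :: complex_inner)"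
  using cinner_add_left[of "x - y" y z] by simp

lemma cinner_diff_right: "cinner x (y - z) = cinner x y - cinner x (z :: 'a :: complex_inner)"
  using cinner_add_right[of x "y - z" z] by simp

lemma cinner_sum_left: "cinner (sum f I) (y :: 'a :: complex_inner) = (\<Sum>i\<in>I. cinner (f i) y)"
  by (induction I rule: infinite_finite_induct) (auto simp: cinner_add_left)

lemma cinner_self: "cinner x x = complex_of_real ((norm (x :: 'a :: complex_inner))\<^sup>2)"
proof -
  have "Im (cinner x x) = 0" using arg_cong[OF cinner_commute[of x x], of Im] by simp
  moreover have "Re (cinner x x) = (norm x)\<^sup>2"
    by (simp flip: inner_eq_Re_cinner add: power2_norm_eq_inner)
  ultimately show ?thesis by (simp add: complex_eq_iff)
qed

lemma unit_iff_cinner: "norm (x :: 'a :: complex_inner) = 1 \<longleftrightarrow> cinner x x = 1"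
  by (metis cinner_self norm_ge_zero of_real_eq_1_iff power2_eq_1_iff power_one
      neg_0_le_iff_le not_one_le_zero)

lemma cinner_zero_commute: "cinner x y = 0 \<Longrightarrow> cinner y (x :: 'a :: complex_inner) = 0"
  by (metis cinner_commute complex_cnj_zero)

lemma norm_scaleC: "norm (a *\<^sub>C (x :: 'a :: complex_inner)) = cmod a * norm x"
proof -
  have "complex_of_real ((norm (a *\<^sub>C x))\<^sup>2) = a * cnj a * cinner x x"
    unfolding cinner_self[symmetric] by (simp add: cinner_scaleC_left cinner_scaleC_right)
  also have "\<dots> = complex_of_real ((cmod a * norm x)\<^sup>2)"
    by (simp add: cinner_self power_mult_distrib complex_norm_square del: of_real_power)
  finally have "(norm (a *\<^sub>C x))\<^sup>2 = (cmod a * norm x)\<^sup>2" by (simp only: of_real_eq_iff)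
  then show ?thesis by simp
qed

lemma norm_add_scaleC_sq:
  "(norm (x + a *\<^sub>C y))\<^sup>2 = (norm x)\<^sup>2 + (cmod a)\<^sup>2 * (norm y)\<^sup>2
     + 2 * Re (a * cinner y (x :: 'a :: complex_inner))"
proof -
  have "(norm (x + a *\<^sub>C y))\<^sup>2 = (norm x)\<^sup>2 + (norm (a *\<^sub>C y))\<^sup>2 + 2 * inner (a *\<^sub>C y) x"
    by (simp add: power2_norm_eq_inner inner_add_left inner_add_right inner_commute)
  then show ?thesis
    by (simp only: inner_eq_Re_cinner cinner_scaleC_left norm_scaleC power_mult_distrib)
qed

lemma bounded_linear_scaleC_left: "bounded_linear (\<lambda>a. a *\<^sub>C (x :: 'a :: complex_inner))"
  by (rule bounded_linear_intro[where K = "norm x"])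
    (auto simp: scaleC_add_left scaleR_scaleC scaleC_scaleC norm_scaleC scaleR_conv_of_real)

lemma
  assumes "clinear f"
  shows clinear_add: "f (x + y) = f x + f y"
    and clinear_scaleC: "f (a *\<^sub>C x) = a *\<^sub>C f x"
    and clinear_zero: "f 0 = 0"
    and clinear_diff: "f (x - y) = f x - f y"
    and clinear_sum: "f (sum g I) = (\<Sum>i\<in>I. f (g i))"
proof -
  interpret module_hom scaleC scaleC f
    using assms unfolding clinear_def Vector_Spaces.linear_def by blast
  show "f (x + y) = f x + f y" "f (a *\<^sub>C x) = a *\<^sub>C f x" "f 0 = 0" "f (x - y) = f x - f y"
    "f (sum g I) = (\<Sum>i\<in>I. f (g i))"
    by (rule add scale zero diff sum)+
qed

lemma clinearI:
  assumes "\<And>x y. f (x + y) = f x + f y" and "\<And>a x. f (a *\<^sub>C x) = a *\<^sub>C f x"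
  shows "clinear f"
  unfolding clinear_def Vector_Spaces.linear_def module_hom_def module_hom_axioms_def
  using assms by (auto intro: complex_vector.vector_space_axioms complex_vector.module_axioms)

definition orthonormal_on :: "'i set \<Rightarrow> ('i \<Rightarrow> 'a :: complex_inner) \<Rightarrow> bool" where
  "orthonormal_on I x \<longleftrightarrow> (\<forall>i\<in>I. \<forall>j\<in>I. cinner (x i) (x j) = (if i = j then 1 else 0))"

lemma orthonormal_on_norm: "orthonormal_on I x \<Longrightarrow> i \<in> I \<Longrightarrow> norm (x i) = 1"
  by (simp add: orthonormal_on_def unit_iff_cinner)

definition proj_on :: "'i set \<Rightarrow> ('i \<Rightarrow> 'a :: complex_inner) \<Rightarrow> 'a \<Rightarrow> 'a" where
  "proj_on I x y = (\<Sum>i\<in>I. cinner y (x i) *\<^sub>C x i)"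

lemma proj_on_residual_orthogonal:
  assumes "finite I" "orthonormal_on I x" "i \<in> I"
  shows "cinner (y - proj_on I x y) (x i) = 0"
proof -
  have "cinner (proj_on I x y) (x i) = (\<Sum>j\<in>I. cinner y (x j) * (if j = i then 1 else 0))"
    unfolding proj_on_def cinner_sum_left
    using assms by (intro sum.cong) (auto simp: cinner_scaleC_left orthonormal_on_def)
  also have "\<dots> = cinner y (x i)" using assms by (simp add: if_distrib cong: if_cong)
  finally show ?thesis by (simp add: cinner_diff_left)
qed

lemma proj_on_in_span: "proj_on I x y \<in> complex_vector.span (x ` I)"
  unfolding proj_on_def
  by (intro complex_vector.span_sum complex_vector.span_scale complex_vector.span_base) auto

lemma orthogonal_to_span:
  assumes "\<And>v. v \<in> S \<Longrightarrow> cinner u v = 0" "v \<in> complex_vector.span S"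
  shows "cinner u v = 0"
  using assms(2)
  by (induction rule: complex_vector.span_induct_alt)
    (auto simp: assms(1) cinner_add_right cinner_scaleC_right)

lemma norm_proj_on_residual_le:
  assumes "finite I" "orthonormal_on I x"
  shows "norm (y - proj_on I x y) \<le> norm y"
proof -
  let ?u = "y - proj_on I x y"
  have "cinner ?u (proj_on I x y) = 0"
    by (rule orthogonal_to_span[OF _ proj_on_in_span[of I x y]])
       (auto intro: proj_on_residual_orthogonal[OF assms])
  then have "(norm (?u + 1 *\<^sub>C proj_on I x y))\<^sup>2 = (norm ?u)\<^sup>2 + (norm (proj_on I x y))\<^sup>2"
    by (subst norm_add_scaleC_sq) (auto dest: cinner_zero_commute)
  then have "(norm ?u)\<^sup>2 \<le> (norm y)\<^sup>2" by (simp add: scaleC_one)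
  then show ?thesis by simp
qed

lemma clinear_proj_on: "clinear (proj_on I x)"
  by (rule clinearI)
    (auto simp: proj_on_def cinner_add_left cinner_scaleC_left scaleC_add_left sum.distrib
      complex_vector.scale_sum_right scaleC_scaleC)

lemma orthonormal_on_Suc:
  assumes "orthonormal_on {..<n} x" "cinner u u = 1" "\<And>i. i < n \<Longrightarrow> cinner u (x i) = 0"
  shows "orthonormal_on {..<Suc n} (x(n := u))"
  using assms(1,2) assms(3) assms(3)[THEN cinner_zero_commute]
  by (auto simp: orthonormal_on_def less_Suc_eq)

text \<open>
  One Gram--Schmidt step. The explicit form of \<open>u\<close> lets \<open>v\<close> be recovered from \<open>u\<close>, and shows that \<open>u\<close> stays
  in any subspace containing \<open>v\<close> and the family.
\<close>

lemma orthonormal_on_extend: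
  fixes x :: "nat \<Rightarrow> 'a :: complex_inner"
  assumes x: "orthonormal_on {..<n} x" and v: "v \<notin> complex_vector.span (x ` {..<n})"
  obtains a u where "a \<noteq> 0" "u = a *\<^sub>C (v - proj_on {..<n} x v)" "orthonormal_on {..<Suc n} (x(n := u))"
proof -
  define w where "w = v - proj_on {..<n} x v"
  have "w \<noteq> 0" using v proj_on_in_span[of "{..<n}" x v] by (auto simp: w_def)
  define a where "a = complex_of_real (inverse (norm w))"
  define u where "u = a *\<^sub>C w"
  have "norm u = 1" using \<open>w \<noteq> 0\<close> by (simp add: u_def a_def norm_scaleC norm_inverse)
  then have uu: "cinner u u = 1" by (simp add: unit_iff_cinner)
  have ux: "cinner u (x i) = 0" if "i < n" for i
    using proj_on_residual_orthogonal[OF _ x, of i v] that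
    by (simp add: u_def cinner_scaleC_left w_def)
  have "orthonormal_on {..<Suc n} (x(n := u))"
    by (rule orthonormal_on_Suc[OF x uu ux])
  moreover have "a \<noteq> 0" using \<open>w \<noteq> 0\<close> by (simp add: a_def)
  ultimately show thesis using that u_def w_def by blast
qed

lemma orthonormal_spanning_finite_set:
  assumes "finite F"
  shows "\<exists>n (x :: nat \<Rightarrow> 'a :: complex_inner). orthonormal_on {..<n} x
           \<and> F \<subseteq> complex_vector.span (x ` {..<n})"
  using assms
proof (induction F)
  case empty
  show ?case by (rule exI[of _ 0]) (auto simp: orthonormal_on_def)
next
  case (insert v F)
  then obtain n and x :: "nat \<Rightarrow> 'a" where nx: "orthonormal_on {..<n} x"
    "F \<subseteq> complex_vector.span (x ` {..<n})" by blast
  show ?case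
  proof (cases "v \<in> complex_vector.span (x ` {..<n})")
    case True
    then show ?thesis using nx by blast
  next
    case False
    then obtain a u where au: "a \<noteq> 0" "u = a *\<^sub>C (v - proj_on {..<n} x v)"
      "orthonormal_on {..<Suc n} (x(n := u))" by (rule orthonormal_on_extend[OF nx(1)])
    let ?S = "complex_vector.span ((x(n := u)) ` {..<Suc n})"
    have sub: "complex_vector.span (x ` {..<n}) \<subseteq> ?S"
      by (intro complex_vector.span_mono) auto
    have "u \<in> ?S" by (intro complex_vector.span_base) auto
    then have "inverse a *\<^sub>C u + proj_on {..<n} x v \<in> ?S"
      using sub proj_on_in_span[of "{..<n}" x v]
      by (intro complex_vector.span_add complex_vector.span_scale) auto
    then have "v \<in> ?S" using au(1) by (simp add: au(2) scaleC_scaleC scaleC_one)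
    then show ?thesis using au(3) nx(2) sub by blast
  qed
qed

lemma orthonormal_in_subspace:
  assumes L: "complex_vector.subspace (L :: 'a :: complex_inner set)" and n: "cdim_at_least n L"
  shows "\<exists>x. orthonormal_on {..<n} x \<and> (\<forall>i<n. x i \<in> L)"
proof -
  have "k \<le> n \<Longrightarrow> \<exists>x. orthonormal_on {..<k} x \<and> (\<forall>i<k. x i \<in> L)" for k
  proof (induction k)
    case 0
    show ?case by (auto simp: orthonormal_on_def)
  next
    case (Suc k)
    then obtain x where x: "orthonormal_on {..<k} x" "\<forall>i<k. x i \<in> L" by auto
    have "\<not> L \<subseteq> complex_vector.span (x ` {..<k})"
    proof
      assume sub: "L \<subseteq> complex_vector.span (x ` {..<k})"
      then have "\<not> infinite_cdim L" unfolding infinite_cdim_def by blast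
      then have "n \<le> complex_vector.dim L" using n by (auto simp: cdim_at_least_def)
      also have "\<dots> \<le> card (x ` {..<k})" using sub by (intro complex_vector.dim_le_card) auto
      also have "\<dots> \<le> k" using card_image_le[of "{..<k}" x] by simp
      finally show False using Suc.prems by simp
    qed
    then obtain v where v: "v \<in> L" "v \<notin> complex_vector.span (x ` {..<k})" by blast
    obtain a u where au: "a \<noteq> 0" "u = a *\<^sub>C (v - proj_on {..<k} x v)"
      "orthonormal_on {..<Suc k} (x(k := u))" by (rule orthonormal_on_extend[OF x(1) v(2)])
    have "complex_vector.span (x ` {..<k}) \<subseteq> L"
      using x(2) by (intro complex_vector.span_minimal L) auto
    then have "u \<in> L" unfolding au(2) using v proj_on_in_span[of "{..<k}" x v] L
      by (intro complex_vector.subspace_scale complex_vector.subspace_diff) auto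
    then have "\<forall>i<Suc k. (x(k := u)) i \<in> L" using x(2) by (auto simp: less_Suc_eq)
    then show ?case using au(3) by blast
  qed
  then show ?thesis by blast
qed

lemma orthonormal_on_independent:
  assumes "finite I" "orthonormal_on I x"
  shows "inj_on x I" "complex_vector.independent (x ` I)"
proof -
  show inj: "inj_on x I"
    by (rule inj_onI) (metis assms(2) orthonormal_on_def zero_neq_one)
  show "complex_vector.independent (x ` I)"
    unfolding complex_vector.dependent_def
  proof
    assume "\<exists>a\<in>x ` I. a \<in> complex_vector.span (x ` I - {a})"
    then obtain i where i: "i \<in> I" "x i \<in> complex_vector.span (x ` I - {x i})" by blast
    have "cinner (x i) (x i) = 0"
      by (rule orthogonal_to_span[OF _ i(2)]) (use assms(2) i(1) in \<open>auto simp: orthonormal_on_def\<close>)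
    then show False using assms(2) i(1) by (auto simp: orthonormal_on_def)
  qed
qed

section \<open>Adjoints\<close>

text \<open>
  A vector of least norm on the hyperplane \<open>\<phi> = 1\<close> exists because a minimising sequence is Cauchy by the
  parallelogram law; minimality makes it orthogonal to the kernel of \<open>\<phi>\<close>.
\<close>

lemma riesz_representation:
  fixes \<phi> :: "'a :: {real_inner, complete_space} \<Rightarrow> real"
  assumes "bounded_linear \<phi>"
  shows "\<exists>w. \<forall>x. \<phi> x = inner x w"
proof (cases "\<forall>x. \<phi> x = 0")
  case True
  then show ?thesis by (intro exI[of _ 0]) auto
next
  case False
  interpret bounded_linear \<phi> by fact
  from False obtain x0 where x0: "\<phi> x0 \<noteq> 0" by blast
  define S where "S = {x. \<phi> x = 1}"
  define D where "D = (INF x\<in>S. (norm x)\<^sup>2)"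
  have "inverse (\<phi> x0) *\<^sub>R x0 \<in> S" using x0 by (simp add: S_def scaleR)
  then have S: "S \<noteq> {}" by blast
  have bdd: "bdd_below ((\<lambda>x. (norm x)\<^sup>2) ` S)" by (rule bdd_belowI[of _ 0]) auto
  have D: "D \<le> (norm x)\<^sup>2" if "x \<in> S" for x
    unfolding D_def using bdd that by (rule cINF_lower)
  have "\<exists>x\<in>S. (norm x)\<^sup>2 < D + 1 / real (Suc n)" for n
    using cINF_less_iff[OF S bdd, of "D + 1 / real (Suc n)"] unfolding D_def by simp
  then obtain u where u: "\<And>n. u n \<in> S" "\<And>n. (norm (u n))\<^sup>2 < D + 1 / real (Suc n)" by metis
  have close: "(norm (u n - u k))\<^sup>2 \<le> 2 / real (Suc n) + 2 / real (Suc k)" for n k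
  proof -
    have "(1/2) *\<^sub>R (u n + u k) \<in> S" using u(1)[of n] u(1)[of k] by (simp add: S_def scaleR add)
    from D[OF this] have "4 * D \<le> (norm (u n + u k))\<^sup>2" by (simp add: power_divide)
    moreover have "(norm (u n - u k))\<^sup>2 = 2 * (norm (u n))\<^sup>2 + 2 * (norm (u k))\<^sup>2 - (norm (u n + u k))\<^sup>2"
      by (simp add: power2_norm_eq_inner algebra_simps inner_commute)
    ultimately show ?thesis using u(2)[of n] u(2)[of k] by simp
  qed
  have "Cauchy u"
  proof (rule metric_CauchyI)
    fix e :: real assume e: "e > 0"
    obtain N where N: "4 / e\<^sup>2 < real N" using reals_Archimedean2 by blast
    have "dist (u n) (u k) < e" if "n \<ge> N" "k \<ge> N" for n k
    proof -
      have "4 / e\<^sup>2 < real (Suc N)" using N by simp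
      then have "4 < e\<^sup>2 * real (Suc N)" using e by (simp only: pos_divide_less_eq mult.commute zero_less_power)
      have "2 / real (Suc n) + 2 / real (Suc k) \<le> 2 / real (Suc N) + 2 / real (Suc N)"
        using that by (intro add_mono divide_left_mono) auto
      also have "\<dots> = 4 / real (Suc N)" by (simp del: of_nat_Suc)
      also have "\<dots> < e\<^sup>2" using \<open>4 < e\<^sup>2 * _\<close> by (simp only: pos_divide_less_eq of_nat_0_less_iff zero_less_Suc)
      finally have "(norm (u n - u k))\<^sup>2 < e\<^sup>2" using close[of n k] by simp
      then show ?thesis using e by (auto simp: dist_norm intro: power2_less_imp_less)
    qed
    then show "\<exists>M. \<forall>m\<ge>M. \<forall>n\<ge>M. dist (u m) (u n) < e" by blast
  qed
  then obtain w where w: "u \<longlonglongrightarrow> w" using Cauchy_convergent_iff convergent_def by blast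
  have "(\<lambda>n. \<phi> (u n)) \<longlonglongrightarrow> \<phi> w" using w by (rule tendsto)
  moreover have "(\<lambda>n. \<phi> (u n)) = (\<lambda>n. 1)" using u(1) by (auto simp: S_def)
  ultimately have pw: "\<phi> w = 1" by (simp add: LIMSEQ_const_iff)
  have "(norm w)\<^sup>2 \<le> D + 0"
  proof (rule LIMSEQ_le)
    show "(\<lambda>n. (norm (u n))\<^sup>2) \<longlonglongrightarrow> (norm w)\<^sup>2" using w by (intro tendsto_intros)
    show "(\<lambda>n. D + 1 / real (Suc n)) \<longlonglongrightarrow> D + 0"
      by (intro tendsto_intros LIMSEQ_Suc[OF lim_1_over_n])
    show "\<exists>N. \<forall>n\<ge>N. (norm (u n))\<^sup>2 \<le> D + 1 / real (Suc n)" using u(2) less_imp_le by blast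
  qed
  then have min: "(norm w)\<^sup>2 \<le> (norm x)\<^sup>2" if "\<phi> x = 1" for x 
    using D[of x] that \<open>(norm w)\<^sup>2 \<le> D + 0\<close> unfolding S_def mem_Collect_eq by linarith
  have orth: "inner v w = 0" if v: "\<phi> v = 0" for v
  proof -
    \<comment> \<open>Moving from \<open>w\<close> by \<open>- a d v\<close> stays on the hyperplane, and would shorten \<open>w\<close> if \<open>d \<noteq> 0\<close>.\<close>
    let ?d = "inner v w" let ?a = "1 / (1 + (norm v)\<^sup>2)"
    have pos: "1 + (norm v)\<^sup>2 > 0" by (smt (verit) zero_le_power2)
    have expand: "(norm (w - t *\<^sub>R v))\<^sup>2 = (norm w)\<^sup>2 - 2 * t * ?d + t\<^sup>2 * (norm v)\<^sup>2" for t
      by (simp add: power2_norm_eq_inner inner_diff inner_commute algebra_simps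
          power2_eq_square[of t])
    have "(norm w)\<^sup>2 \<le> (norm (w - (?a * ?d) *\<^sub>R v))\<^sup>2"
      by (rule min) (simp add: diff scaleR pw v)
    also have "\<dots> = (norm w)\<^sup>2 - 2 * ?a * ?d\<^sup>2 + ?a\<^sup>2 * ?d\<^sup>2 * (norm v)\<^sup>2"
      unfolding expand by (simp add: power2_eq_square[of ?d] power_mult_distrib power_divide)
    also have "?a\<^sup>2 * ?d\<^sup>2 * (norm v)\<^sup>2 = ?a * ?d\<^sup>2 * (?a * (norm v)\<^sup>2)"
      by (simp add: power2_eq_square)
    also have "\<dots> \<le> ?a * ?d\<^sup>2 * 1"
      using pos by (intro mult_left_mono) (auto simp: field_simps)
    finally have "?a * ?d\<^sup>2 \<le> 0" by simp
    then show ?thesis using pos by (simp add: divide_le_0_iff)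
  qed
  have "w \<noteq> 0" using pw zero by auto
  have "\<phi> x = inner x (inverse ((norm w)\<^sup>2) *\<^sub>R w)" for x
  proof -
    have "inner (x - \<phi> x *\<^sub>R w) w = 0" by (rule orth) (simp add: diff scaleR pw)
    then show ?thesis using \<open>w \<noteq> 0\<close>
      by (simp add: inner_diff_left power2_norm_eq_inner field_simps)
  qed
  then show ?thesis by blast
qed

text \<open>
  Only the vector \<open>B\<^bsup>*\<^esup> v\<close> for one \<open>v\<close> at a time is needed: it turns the condition \<open>Bx \<bottom> v\<close> into the
  orthogonality of \<open>x\<close> to a fixed vector. Representing the real part suffices, since applying
  it to \<open>\<i> x\<close> recovers the imaginary part.
\<close>

lemma adjoint_vector:
  fixes B :: "'a :: chilbert_space \<Rightarrow> 'a"
  assumes "bounded_clinear B"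
  shows "\<exists>w. \<forall>x. cinner (B x) v = cinner x w"
proof -
  have B: "clinear B" "bounded_linear B" using assms by (auto simp: bounded_clinear_def)
  have "bounded_linear (\<lambda>x. inner (B x) v)"
    by (rule bounded_linear_compose[OF bounded_linear_inner_left B(2)])
  then obtain w where w: "\<And>x. inner (B x) v = inner x w" using riesz_representation by blast
  have "cinner (B x) v = cinner x w" for x
  proof (rule complex_eqI)
    show "Re (cinner (B x) v) = Re (cinner x w)" using w[of x] by (simp add: inner_eq_Re_cinner)
    show "Im (cinner (B x) v) = Im (cinner x w)"
      using w[of "\<i> *\<^sub>C x"]
      by (simp add: inner_eq_Re_cinner clinear_scaleC[OF B(1)] cinner_scaleC_left)
  qed
  then show ?thesis by blast
qed

section \<open>Almost norming vectors away from finite sets\<close>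

lemma cmod_cinner_le_norm:
  assumes "norm (e :: 'a :: complex_inner) = 1"
  shows "cmod (cinner y e) \<le> norm y"
proof -
  let ?c = "cinner y e"
  have "?c * cinner e y = complex_of_real ((cmod ?c)\<^sup>2)"
    unfolding complex_norm_square by (subst cinner_commute[of e y]) simp
  then have "Re (- ?c * cinner e y) = - (cmod ?c)\<^sup>2" by simp
  then have "(norm (y + (- ?c) *\<^sub>C e))\<^sup>2 = (norm y)\<^sup>2 - (cmod ?c)\<^sup>2"
    using assms by (subst norm_add_scaleC_sq) simp
  then have "(cmod ?c)\<^sup>2 \<le> (norm y)\<^sup>2" by (metis diff_ge_0_iff_ge zero_le_power2)
  then show ?thesis by simp
qed

lemma compact_bounded_combinations:
  fixes w :: "'i \<Rightarrow> 'a :: complex_inner"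
  assumes "finite I"
  shows "compact {\<Sum>i\<in>I. a i *\<^sub>C w i | a. \<forall>i\<in>I. cmod (a i) \<le> 1}"
  using assms
proof (induction I)
  case empty
  show ?case by simp
next
  case (insert i I)
  let ?S = "{\<Sum>i\<in>I. a i *\<^sub>C w i | a. \<forall>i\<in>I. cmod (a i) \<le> 1}"
  let ?D = "(\<lambda>a. a *\<^sub>C w i) ` cball 0 1"
  have "compact ?D"
    by (rule compact_continuous_image[OF bounded_linear.continuous_on[OF
            bounded_linear_scaleC_left continuous_on_id] compact_cball])
  then have comp: "compact {x + y | x y. x \<in> ?D \<and> y \<in> ?S}" using insert.IH by (rule compact_sums)
  have "{\<Sum>j\<in>insert i I. a j *\<^sub>C w j | a. \<forall>j\<in>insert i I. cmod (a j) \<le> 1}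
      = {x + y | x y. x \<in> ?D \<and> y \<in> ?S}" (is "?L = ?R")
  proof
    show "?L \<subseteq> ?R"
    proof
      fix z assume "z \<in> ?L"
      then obtain a where a: "z = (\<Sum>j\<in>insert i I. a j *\<^sub>C w j)"
        "\<forall>j\<in>insert i I. cmod (a j) \<le> 1" by blast
      have "z = a i *\<^sub>C w i + (\<Sum>j\<in>I. a j *\<^sub>C w j)" using a(1) insert.hyps by simp
      moreover have "a i *\<^sub>C w i \<in> ?D" using a(2) by (intro imageI) simp
      moreover have "(\<Sum>j\<in>I. a j *\<^sub>C w j) \<in> ?S" using a(2) by blast
      ultimately show "z \<in> ?R" by blast
    qed
    show "?R \<subseteq> ?L"
    proof
      fix z assume "z \<in> ?R"
      then obtain b a where z: "z = b *\<^sub>C w i + (\<Sum>j\<in>I. a j *\<^sub>C w j)"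
        "cmod b \<le> 1" "\<forall>j\<in>I. cmod (a j) \<le> 1" by auto
      have "(\<Sum>j\<in>I. (a(i := b)) j *\<^sub>C w j) = (\<Sum>j\<in>I. a j *\<^sub>C w j)"
        using insert.hyps by (intro sum.cong) auto
      then have "z = (\<Sum>j\<in>insert i I. (a(i := b)) j *\<^sub>C w j)" using z insert.hyps by simp
      moreover have "\<forall>j\<in>insert i I. cmod ((a(i := b)) j) \<le> 1" using z by simp
      ultimately show "z \<in> ?L" by blast
    qed
  qed
  then show ?case using comp by simp
qed

text \<open>
  By Cauchy--Schwarz, the coefficients of the projection of a vector in the unit ball lie in the unit
  disc, so the image lies in a compact set of bounded combinations.
\<close>

lemma compact_operator_finite_rank:
  fixes x :: "'i \<Rightarrow> 'a :: complex_inner"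
  assumes I: "finite I" "orthonormal_on I x" and B: "bounded_clinear (B :: 'a \<Rightarrow> 'a)"
  shows "compact_operator (\<lambda>y. - B (proj_on I x y))"
proof -
  have lin: "clinear B" "bounded_linear B" using B by (auto simp: bounded_clinear_def)
  note P = clinear_proj_on[of I x]
  have "bounded_linear (proj_on I x)"
  proof (rule bounded_linear_intro[where K = 2])
    show "norm (proj_on I x y) \<le> norm y * 2" for y
      using norm_proj_on_residual_le[OF I, of y] norm_triangle_ineq4[of y "y - proj_on I x y"]
      by simp
  qed (auto simp: clinear_add[OF P] clinear_scaleC[OF P] scaleR_scaleC)
  then have "bounded_linear (\<lambda>y. - B (proj_on I x y))"
    by (intro bounded_linear_minus bounded_linear_compose[OF lin(2)])
  moreover have "clinear (\<lambda>y. - B (proj_on I x y))"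
    by (rule clinearI) (auto simp: clinear_add[OF P] clinear_scaleC[OF P] clinear_add[OF lin(1)]
        clinear_scaleC[OF lin(1)] complex_vector.scale_minus_right)
  moreover have "compact (closure ((\<lambda>y. - B (proj_on I x y)) ` cball 0 1))"
  proof -
    let ?S = "{\<Sum>i\<in>I. a i *\<^sub>C B (x i) | a. \<forall>i\<in>I. cmod (a i) \<le> 1}"
    have S: "compact ?S" by (rule compact_bounded_combinations[OF I(1)])
    have "(\<lambda>y. - B (proj_on I x y)) ` cball 0 1 \<subseteq> ?S"
    proof
      fix z assume "z \<in> (\<lambda>y. - B (proj_on I x y)) ` cball 0 1"
      then obtain y where y: "norm y \<le> 1" "z = - B (proj_on I x y)" by auto
      have "z = (\<Sum>i\<in>I. (- cinner y (x i)) *\<^sub>C B (x i))"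
        by (simp add: y(2) proj_on_def clinear_sum[OF lin(1)] clinear_scaleC[OF lin(1)]
            complex_vector.scale_minus_left sum_negf)
      moreover have "\<forall>i\<in>I. cmod (- cinner y (x i)) \<le> 1"
        using order_trans[OF cmod_cinner_le_norm[OF orthonormal_on_norm[OF I(2)]] y(1)] by simp
      ultimately show "z \<in> ?S"
        by (intro CollectI exI[of _ "\<lambda>i. - cinner y (x i)"] conjI)
    qed
    then have "closure ((\<lambda>y. - B (proj_on I x y)) ` cball 0 1) \<subseteq> ?S"
      by (rule closure_minimal[OF _ compact_imp_closed[OF S]])
    from compact_Int_closed[OF S closed_closure, of "(\<lambda>y. - B (proj_on I x y)) ` cball 0 1",
        unfolded Int_absorb1[OF this]]
    show ?thesis .
  qed
  ultimately show ?thesis unfolding compact_operator_def bounded_clinear_def by (intro conjI)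
qed

text \<open>
  Otherwise \<open>B\<close> has norm at most \<open>r\<close> on the orthogonal complement of \<open>F\<close>; subtracting the finite rank
  operator \<open>B P\<close>, where \<open>P\<close> projects onto a finite dimensional space containing \<open>F\<close>, would
  push the essential norm down to \<open>r\<close>.
\<close>

lemma ess_norm_norming_vector:
  fixes B :: "'a :: complex_inner \<Rightarrow> 'a"
  assumes B: "bounded_clinear B" and F: "finite F" and r: "0 \<le> r" "r < ess_norm B"
  shows "\<exists>x. norm x = 1 \<and> (\<forall>v\<in>F. cinner x v = 0) \<and> r < norm (B x)"
proof (rule ccontr)
  assume no: "\<not> ?thesis"
  have lin: "clinear B" "bounded_linear B" using B by (auto simp: bounded_clinear_def)
  obtain n and x :: "nat \<Rightarrow> 'a" where nx: "orthonormal_on {..<n} x"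
    "F \<subseteq> complex_vector.span (x ` {..<n})" using orthonormal_spanning_finite_set[OF F] by blast
  let ?P = "proj_on {..<n} x"
  let ?K = "\<lambda>y. - B (?P y)"
  have K: "compact_operator ?K" by (rule compact_operator_finite_rank[OF _ nx(1) B]) simp
  have "onorm (\<lambda>y. B y + ?K y) \<le> r"
  proof (rule onorm_bound[OF r(1)])
    fix y
    define u where "u = y - ?P y"
    have orth: "cinner u v = 0" if "v \<in> F" for v
      by (rule orthogonal_to_span[of "x ` {..<n}"])
        (use that nx proj_on_residual_orthogonal[OF _ nx(1)] in \<open>auto simp: u_def\<close>)
    have "norm (B u) \<le> r * norm u"
    proof (cases "u = 0")
      case True
      then show ?thesis by (simp add: clinear_zero[OF lin(1)])
    next
      case False
      let ?a = "complex_of_real (inverse (norm u))"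
      have "norm (?a *\<^sub>C u) = 1" using False by (simp add: norm_scaleC norm_inverse)
      moreover have "\<forall>v\<in>F. cinner (?a *\<^sub>C u) v = 0" using orth by (simp add: cinner_scaleC_left)
      ultimately have "norm (B (?a *\<^sub>C u)) \<le> r" using no by (meson not_le_imp_less)
      then show ?thesis using False
        by (simp add: clinear_scaleC[OF lin(1)] norm_scaleC norm_divide field_simps)
    qed
    also have "\<dots> \<le> r * norm y"
      using norm_proj_on_residual_le[OF _ nx(1), of y] r(1) by (simp add: u_def mult_left_mono)
    finally show "norm (B y + ?K y) \<le> r * norm y" by (simp add: u_def clinear_diff[OF lin(1)])
  qed
  moreover have "ess_norm B \<le> onorm (\<lambda>y. B y + ?K y)"
    unfolding ess_norm_def
  proof (rule cInf_lower)
    show "bdd_below {onorm (\<lambda>x. B x + K x) |K. compact_operator K}"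
      by (rule bdd_belowI[of _ 0])
        (auto intro!: onorm_pos_le bounded_linear_add lin(2)
          simp: compact_operator_def bounded_clinear_def)
    show "onorm (\<lambda>y. B y + ?K y) \<in> {onorm (\<lambda>x. B x + K x) |K. compact_operator K}"
      by (intro CollectI exI[of _ ?K] conjI K refl)
  qed
  ultimately have "ess_norm B \<le> r" by (rule order_trans[rotated])
  then show False using r(2) by simp
qed

section \<open>Orthonormal pairs exchanged by a square root of a scalar\<close>

text \<open>
  On the plane of \<open>x i\<close> and \<open>y i\<close> the operator has the matrix with zero diagonal and off-diagonal entries
  \<open>t i\<close> and \<open>\<delta> / t i\<close>. Their moduli are its singular values, and every square root of the scalar \<open>\<delta>\<close> on a plane
  that is not itself scalar has this form in a suitable orthonormal basis.
  For \<open>t i = 0\<close> the quotient is \<open>0\<close>, which covers the zero operator.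
\<close>

definition exchanged_pairs ::
    "('a :: complex_inner \<Rightarrow> 'a) \<Rightarrow> complex \<Rightarrow> nat \<Rightarrow> (nat \<Rightarrow> 'a) \<Rightarrow> (nat \<Rightarrow> 'a) \<Rightarrow> (nat \<Rightarrow> real) \<Rightarrow> bool" where
  "exchanged_pairs B \<delta> m x y t \<longleftrightarrow>
     orthonormal_on {..<m} x \<and> orthonormal_on {..<m} y \<and> (\<forall>i<m. \<forall>j<m. cinner (x i) (y j) = 0) \<and>
     (\<forall>i<m. B (x i) = complex_of_real (t i) *\<^sub>C y i \<and> B (y i) = (\<delta> / complex_of_real (t i)) *\<^sub>C x i)"

text \<open>
  The form \<open>t\<^sup>2 \<langle>u, v\<rangle> - \<langle>Bu, Bv\<rangle>\<close> is positive semidefinite on the span of \<open>x\<close> and \<open>v\<close> and vanishes at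
  \<open>(x, x)\<close>, so \<open>x\<close> lies in its radical. This replaces the equation \<open>B\<^bsup>*\<^esup>B x = t\<^sup>2 x\<close>.
\<close>

lemma cinner_image_at_maximal_vector:
  fixes B :: "'a :: complex_inner \<Rightarrow> 'a"
  assumes B: "clinear B" and x: "norm (B x) = t * norm x"
    and le: "\<And>a. norm (B (x + a *\<^sub>C v)) \<le> t * norm (x + a *\<^sub>C v)" and t: "t \<ge> 0"
  shows "cinner (B x) (B v) = complex_of_real (t\<^sup>2) * cinner x v"
proof -
  define d where "d = complex_of_real (t\<^sup>2) * cinner v x - cinner (B v) (B x)"
  define q where "q = t\<^sup>2 * (norm v)\<^sup>2 - (norm (B v))\<^sup>2"
  have pos: "0 \<le> (cmod a)\<^sup>2 * q + 2 * Re (a * d)" for a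
  proof -
    have "(norm (B (x + a *\<^sub>C v)))\<^sup>2 \<le> (t * norm (x + a *\<^sub>C v))\<^sup>2"
      using le by (intro power_mono) auto
    then have "(norm (B x + a *\<^sub>C B v))\<^sup>2 \<le> t\<^sup>2 * (norm (x + a *\<^sub>C v))\<^sup>2"
      by (simp add: clinear_add[OF B] clinear_scaleC[OF B] power_mult_distrib)
    then show ?thesis
      unfolding norm_add_scaleC_sq x power_mult_distrib d_def q_def
      by (simp add: algebra_simps)
  qed
  \<comment> \<open>Moving along \<open>a = - e d\<^bsup>*\<^esup>\<close> makes the linear term \<open>-2 e \<bar>d\<bar>\<^sup>2\<close> dominate as soon as \<open>e q \<le> 1\<close>.\<close>
  define e where "e = 1 / (\<bar>q\<bar> + 1)"
  have e: "e > 0" "e * q \<le> 1" unfolding e_def by (auto simp: field_simps)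
  have "Re (complex_of_real (- e) * cnj d * d) = - e * (cmod d)\<^sup>2"
    unfolding mult.assoc mult.commute[of "cnj d"] complex_norm_square[symmetric] by simp
  moreover have "(cmod (complex_of_real (- e) * cnj d))\<^sup>2 = e\<^sup>2 * (cmod d)\<^sup>2"
    by (simp add: norm_mult power_mult_distrib)
  ultimately have "0 \<le> e\<^sup>2 * (cmod d)\<^sup>2 * q + 2 * (- e * (cmod d)\<^sup>2)"
    using pos[of "complex_of_real (- e) * cnj d"] by simp
  also have "\<dots> = e * (cmod d)\<^sup>2 * (e * q - 2)" by (simp add: power2_eq_square algebra_simps)
  also have "\<dots> \<le> e * (cmod d)\<^sup>2 * (- 1)" using e by (intro mult_left_mono) auto
  finally have "(cmod d)\<^sup>2 \<le> 0" using e(1) by (simp add: mult_le_0_iff zero_less_mult_iff)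
  then have "d = 0" by simp
  then have "cnj (cinner (B v) (B x)) = cnj (complex_of_real (t\<^sup>2) * cinner v x)" by (simp add: d_def)
  then show ?thesis by (simp add: cinner_commute[symmetric])
qed

text \<open>
  With \<open>B\<^sup>2 = \<delta>\<close>, the two equations give \<open>\<bar>\<delta>\<bar> a = t\<^sup>2 b\<close> and \<open>\<bar>\<delta>\<bar> b = t\<^sup>2 a\<close> for
  \<open>a = \<bar>\<langle>Bx, x'\<rangle>\<bar>\<close> and \<open>b = \<bar>\<langle>Bx', x\<rangle>\<bar>\<close>; as \<open>\<bar>\<delta>\<bar> < t\<^sup>2\<close>, both vanish. The case \<open>x' = x\<close> is included.
\<close>

lemma maximal_vector_images_orthogonal:
  fixes B :: "'a :: complex_inner \<Rightarrow> 'a"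
  assumes sq: "\<And>x. B (B x) = \<delta> *\<^sub>C x" and t: "cmod \<delta> < t\<^sup>2"
    and x: "cinner (B x) (B (B x')) = complex_of_real (t\<^sup>2) * cinner x (B x')"
    and x': "cinner (B x') (B (B x)) = complex_of_real (t\<^sup>2) * cinner x' (B x)"
  shows "cinner (B x) x' = 0"
proof -
  let ?a = "cmod (cinner (B x) x')" and ?b = "cmod (cinner (B x') x)"
  have 1: "cmod \<delta> * ?a = t\<^sup>2 * ?b"
    using arg_cong[OF x, of cmod] complex_mod_cnj[of "cinner (B x') x"]
    unfolding cinner_commute[of "B x'" x, symmetric]
    by (simp add: sq cinner_scaleC_right norm_mult norm_power cinner_commute[of x])
  have 2: "cmod \<delta> * ?b = t\<^sup>2 * ?a"
    using arg_cong[OF x', of cmod]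
    by (simp add: sq cinner_scaleC_right norm_mult norm_power cinner_commute[of x'])
  have "(t\<^sup>2 - cmod \<delta>) * (?a + ?b) = 0" using 1 2 by (simp add: algebra_simps)
  then have "?a + ?b = 0" using t by simp
  then show ?thesis by (smt (verit) norm_ge_zero norm_eq_zero)
qed

text \<open>
  The span of \<open>x\<close> and \<open>Bx\<close> is invariant under \<open>B\<close>. If \<open>u\<close> maximises \<open>\<parallel>Bv\<parallel>/\<parallel>v\<parallel>\<close> there, with maximum \<open>t\<close>,
  then \<open>Bu\<close> is orthogonal to \<open>u\<close>, and \<open>u\<close>, \<open>Bu/t\<close> is the pair. The bound on \<open>\<delta>\<close> excludes that \<open>x\<close>
  is an eigenvector.
\<close>

lemma exchanged_pair_in_span:
  fixes B :: "'a :: complex_inner \<Rightarrow> 'a"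
  assumes B: "bounded_clinear B" and sq: "\<And>x. B (B x) = \<delta> *\<^sub>C x"
    and x: "norm x = 1" and big: "cmod \<delta> < (norm (B x))\<^sup>2"
  shows "\<exists>u v t. norm (B x) \<le> t \<and> cinner u u = 1 \<and> cinner v v = 1 \<and> cinner u v = 0 \<and>
      B u = complex_of_real t *\<^sub>C v \<and> B v = (\<delta> / complex_of_real t) *\<^sub>C u \<and>
      (\<exists>a b. u = a *\<^sub>C x + b *\<^sub>C B x) \<and> (\<exists>a b. v = a *\<^sub>C x + b *\<^sub>C B x)"
proof -
  have lin: "clinear B" "bounded_linear B" using B by (auto simp: bounded_clinear_def)
  define w where "w p = fst p *\<^sub>C x + snd p *\<^sub>C B x" for p :: "complex \<times> complex"
  have Bw: "B (w p) = w (\<delta> * snd p, fst p)" for p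
    by (simp add: w_def clinear_add[OF lin(1)] clinear_scaleC[OF lin(1)] sq scaleC_scaleC
        add.commute mult.commute)
  have wl: "bounded_linear w"
    unfolding w_def
    by (intro bounded_linear_add bounded_linear_compose[OF bounded_linear_scaleC_left]
        bounded_linear_fst bounded_linear_snd)
  have wadd: "w p + a *\<^sub>C w q = w (fst p + a * fst q, snd p + a * snd q)" for p q a
    by (simp add: w_def scaleC_add_left scaleC_add_right scaleC_scaleC)
  \<comment> \<open>A linear relation would make \<open>x\<close> an eigenvector, and then \<open>\<parallel>Bx\<parallel>\<^sup>2 = \<bar>\<delta>\<bar>\<close>.\<close>
  have wnz: "w p \<noteq> 0" if p: "p \<noteq> 0" for p
  proof
    assume 0: "w p = 0"
    show False
    proof (cases "snd p = 0")
      case True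
      then have "fst p = 0" using 0 x by (auto simp: w_def)
      then show False using True p by (simp add: prod_eq_iff)
    next
      case False
      define l where "l = - fst p / snd p"
      have "snd p *\<^sub>C B x = (- fst p) *\<^sub>C x"
        using 0 by (simp add: w_def add_eq_0_iff2 complex_vector.scale_minus_left)
      then have "inverse (snd p) *\<^sub>C (snd p *\<^sub>C B x) = inverse (snd p) *\<^sub>C ((- fst p) *\<^sub>C x)" by simp
      then have Bx: "B x = l *\<^sub>C x"
        using False by (simp only: scaleC_scaleC) (simp add: l_def scaleC_one field_simps)
      have "norm (B (B x)) = (cmod l)\<^sup>2"
        using x by (simp add: Bx clinear_scaleC[OF lin(1)] norm_scaleC norm_mult power2_eq_square)
      moreover have "norm (B (B x)) = cmod \<delta>" using x by (simp only: sq norm_scaleC mult_1_right)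
      moreover have "norm (B x) = cmod l" using x by (simp add: Bx norm_scaleC)
      ultimately have "cmod \<delta> = (norm (B x))\<^sup>2" by simp
      then show False using big by simp
    qed
  qed
  define g where "g p = norm (B (w p)) / norm (w p)" for p
  have "continuous_on (sphere 0 1) g"
    unfolding g_def
  proof (intro continuous_on_divide continuous_on_norm bounded_linear.continuous_on[OF wl]
        bounded_linear.continuous_on[OF lin(2)] continuous_on_id ballI)
    fix p :: "complex \<times> complex" assume "p \<in> sphere 0 1"
    then have "p \<noteq> 0" by auto
    then show "norm (w p) \<noteq> 0" using wnz by simp
  qed
  moreover have e1: "(1, 0) \<in> sphere (0 :: complex \<times> complex) 1" by (simp add: norm_Pair)
  ultimately obtain p where p: "p \<in> sphere 0 1" "\<And>q. q \<in> sphere 0 1 \<Longrightarrow> g q \<le> g p"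
    using continuous_attains_sup[OF compact_sphere, of 0 1 g] by blast
  define t where "t = g p"
  have tx: "norm (B x) \<le> t" using p(2)[OF e1] x by (simp add: t_def g_def w_def scaleC_one)
  have "B x \<noteq> 0" using big by auto
  then have "0 < norm (B x)" by simp
  then have t0: "t > 0" using tx by linarith
  have "(norm (B x))\<^sup>2 \<le> t\<^sup>2" using tx by (intro power_mono) auto
  then have tbig: "cmod \<delta> < t\<^sup>2" using big by simp
  have le: "norm (B (w q)) \<le> t * norm (w q)" for q
  proof (cases "q = 0")
    case True
    then show ?thesis by (simp add: w_def clinear_zero[OF lin(1)])
  next
    case False
    let ?q = "inverse (norm q) *\<^sub>R q"
    have "?q \<in> sphere 0 1" using False by simp
    from p(2)[OF this] have "norm (B (w q)) / norm (w q) \<le> t"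
      using False
      by (simp add: t_def g_def linear_scale[OF bounded_linear.linear[OF wl]] linear_scale[OF bounded_linear.linear[OF lin(2)]])
    then show ?thesis using wnz[OF False] by (simp add: divide_le_eq)
  qed
  have pnz: "w p \<noteq> 0" using p(1) by (intro wnz) auto
  define p' where "p' = inverse (norm (w p)) *\<^sub>R p"
  define u where "u = w p'"
  have u1: "norm u = 1" using pnz by (simp add: u_def p'_def linear_scale[OF bounded_linear.linear[OF wl]])
  have Bu: "norm (B u) = t"
    using pnz by (simp add: u_def p'_def t_def g_def linear_scale[OF bounded_linear.linear[OF wl]]
        linear_scale[OF bounded_linear.linear[OF lin(2)]] field_simps)
  have max: "norm (B (u + a *\<^sub>C B u)) \<le> t * norm (u + a *\<^sub>C B u)" for a
  proof -
    have "u + a *\<^sub>C B u = w (fst p' + a * (\<delta> * snd p'), snd p' + a * fst p')"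
      by (simp add: u_def Bw wadd)
    then show ?thesis using le by (simp only:)
  qed
  define v where "v = complex_of_real (inverse t) *\<^sub>C B u"
  have crit: "cinner (B u) (B (B u)) = complex_of_real (t\<^sup>2) * cinner u (B u)"
    using max t0 by (intro cinner_image_at_maximal_vector lin) (auto simp: Bu u1)
  have "cinner (B u) u = 0"
    by (rule maximal_vector_images_orthogonal[OF sq tbig crit crit])
  then have "cinner u v = 0"
    by (auto simp: v_def cinner_scaleC_right dest: cinner_zero_commute)
  moreover have "cinner v v = 1"
    using t0 Bu by (simp add: v_def norm_scaleC norm_inverse flip: unit_iff_cinner)
  moreover have "B u = complex_of_real t *\<^sub>C v"
    using t0 by (simp add: v_def scaleC_scaleC scaleC_one flip: of_real_mult)
  moreover have "B v = (\<delta> / complex_of_real t) *\<^sub>C u"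
    by (simp add: v_def clinear_scaleC[OF lin(1)] sq scaleC_scaleC divide_inverse mult.commute)
  moreover have "cinner u u = 1" using u1 by (simp add: unit_iff_cinner)
  moreover have "u = fst p' *\<^sub>C x + snd p' *\<^sub>C B x" by (simp add: u_def w_def)
  moreover have "v = (inverse t * (\<delta> * snd p')) *\<^sub>C x + (inverse t * fst p') *\<^sub>C B x"
    unfolding v_def u_def Bw by (simp add: w_def scaleC_add_right scaleC_scaleC)
  ultimately show ?thesis using tx by blast
qed

text \<open>
  A new plane must be orthogonal to the planes found so far. For \<open>z\<close> and \<open>Bz\<close> to be orthogonal to a
  vector \<open>q\<close> it is enough that \<open>z\<close> is orthogonal to \<open>q\<close> and to \<open>B\<^bsup>*\<^esup> q\<close>, so finitely many
  conditions on \<open>z\<close> have to be met.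
\<close>

lemma exchanged_pairs_from_ess_norm:
  fixes B :: "'a :: chilbert_space \<Rightarrow> 'a"
  assumes B: "bounded_clinear B" and sq: "\<And>x. B (B x) = \<delta> *\<^sub>C x"
    and r: "0 \<le> r" "cmod \<delta> \<le> r\<^sup>2" "r < ess_norm B"
  shows "\<exists>x y t. exchanged_pairs B \<delta> m x y t \<and> (\<forall>i<m. r < t i)"
proof (induction m)
  case 0
  show ?case by (auto simp: exchanged_pairs_def orthonormal_on_def)
next
  case (Suc m)
  then obtain x y t where ex: "exchanged_pairs B \<delta> m x y t" and t: "\<forall>i<m. r < t i" by blast
  obtain adj where adj: "\<And>v z. cinner (B z) v = cinner z (adj v)"
    using adjoint_vector[OF B] by metis
  let ?G = "x ` {..<m} \<union> y ` {..<m}"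
  have "finite (?G \<union> adj ` ?G)" by simp
  from ess_norm_norming_vector[OF B this r(1,3)] obtain z where z: "norm z = 1"
    "\<forall>v\<in>?G \<union> adj ` ?G. cinner z v = 0" "r < norm (B z)" by blast
  have "r\<^sup>2 < (norm (B z))\<^sup>2" using z(3) r(1) by (intro power_strict_mono) auto
  then have "cmod \<delta> < (norm (B z))\<^sup>2" using r(2) by simp
  from exchanged_pair_in_span[OF B sq z(1) this]
  obtain u v T a b a' b' where uv: "norm (B z) \<le> T" "cinner u u = 1" "cinner v v = 1" "cinner u v = 0"
    "B u = complex_of_real T *\<^sub>C v" "B v = (\<delta> / complex_of_real T) *\<^sub>C u"
    "u = a *\<^sub>C z + b *\<^sub>C B z" "v = a' *\<^sub>C z + b' *\<^sub>C B z" by blast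
  have orth: "cinner u q = 0" "cinner v q = 0" if "q \<in> ?G" for q
    using z(2) that unfolding uv(7,8) by (auto simp: cinner_add_left cinner_scaleC_left adj)
  note orth' = orth[THEN cinner_zero_commute]
  have "exchanged_pairs B \<delta> (Suc m) (x(m := u)) (y(m := v)) (t(m := T))"
    unfolding exchanged_pairs_def
  proof (intro conjI)
    show "orthonormal_on {..<Suc m} (x(m := u))" "orthonormal_on {..<Suc m} (y(m := v))"
      using ex uv(2,3) orth by (auto simp: exchanged_pairs_def intro!: orthonormal_on_Suc)
    have "cinner u (y j) = 0" "cinner (x j) v = 0" if "j < m" for j
      using that orth(1) orth'(2) by auto
    then show "\<forall>i<Suc m. \<forall>j<Suc m. cinner ((x(m := u)) i) ((y(m := v)) j) = 0"
      using ex uv(4) by (simp add: exchanged_pairs_def less_Suc_eq)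
    show "\<forall>i<Suc m. B ((x(m := u)) i) = complex_of_real ((t(m := T)) i) *\<^sub>C (y(m := v)) i \<and>
        B ((y(m := v)) i) = (\<delta> / complex_of_real ((t(m := T)) i)) *\<^sub>C (x(m := u)) i"
      using ex uv(5,6) by (simp add: exchanged_pairs_def less_Suc_eq)
  qed
  moreover have "\<forall>i<Suc m. r < (t(m := T)) i" using t uv(1) z(3) by (simp add: less_Suc_eq)
  ultimately show ?case by blast
qed

section \<open>Elliptical discs as affine images of the unit disc\<close>

text \<open>
  On the plane of a pair with parameter \<open>t\<close>, the quadratic form of \<open>B\<close> takes the value \<open>ellipse_map \<delta> t \<zeta>\<close>
  at a unit vector \<open>a x + b y\<close>, where \<open>\<zeta> = 2 a\<^bsup>*\<^esup> b\<close> runs over the unit disc. The inverse of this real-linear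
  map, for \<open>\<bar>\<delta>\<bar> < t\<^sup>2\<close>, is \<open>ellipse_coord \<delta> t\<close>.
\<close>

definition ellipse_map :: "complex \<Rightarrow> real \<Rightarrow> complex \<Rightarrow> complex" where
  "ellipse_map \<delta> t \<zeta> = (complex_of_real t * cnj \<zeta> + \<delta> / complex_of_real t * \<zeta>) / 2"

definition ellipse_coord :: "complex \<Rightarrow> real \<Rightarrow> complex \<Rightarrow> complex" where
  "ellipse_coord \<delta> t p = 2 * (complex_of_real t * cnj p - cnj (\<delta> / complex_of_real t) * p)
     / complex_of_real (t\<^sup>2 - (cmod \<delta> / t)\<^sup>2)"

definition focal_sum :: "complex \<Rightarrow> complex \<Rightarrow> real" where
  "focal_sum \<sigma> p = cmod (p - \<sigma>) + cmod (p + \<sigma>)"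

lemma ellipse_coord_denominator_pos:
  assumes "t > 0" "cmod \<delta> < t\<^sup>2"
  shows "0 < t\<^sup>2 - (cmod \<delta> / t)\<^sup>2"
proof -
  have "cmod \<delta> / t < t" using assms by (simp add: divide_less_eq power2_eq_square)
  then have "(cmod \<delta> / t)\<^sup>2 < t\<^sup>2" using assms(1) by (intro power_strict_mono) auto
  then show ?thesis by simp
qed

lemma
  assumes "t > 0" "cmod \<delta> < t\<^sup>2"
  shows ellipse_map_coord: "ellipse_map \<delta> t (ellipse_coord \<delta> t p) = p"
    and ellipse_coord_map: "ellipse_coord \<delta> t (ellipse_map \<delta> t \<zeta>) = \<zeta>"
proof -
  define k where "k = \<delta> / complex_of_real t"
  define D where "D = t\<^sup>2 - (cmod \<delta> / t)\<^sup>2"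
  have ck: "cmod k = cmod \<delta> / t" using assms(1) by (simp add: k_def norm_divide)
  have D: "D \<noteq> 0" using ellipse_coord_denominator_pos[OF assms] by (simp add: D_def)
  have kk: "k * cnj k = complex_of_real ((cmod \<delta> / t)\<^sup>2)"
    using complex_norm_square[of k] ck by simp
  have "complex_of_real t * cnj (ellipse_coord \<delta> t p) + k * ellipse_coord \<delta> t p
      = (2 * (complex_of_real t * (complex_of_real t * p - k * cnj p)
            + k * (complex_of_real t * cnj p - cnj k * p))) / complex_of_real D"
    unfolding ellipse_coord_def k_def[symmetric] D_def[symmetric]
    by (simp add: add_divide_distrib[symmetric] diff_divide_distrib[symmetric] algebra_simps)
  also have "2 * (complex_of_real t * (complex_of_real t * p - k * cnj p)
            + k * (complex_of_real t * cnj p - cnj k * p))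
      = 2 * (complex_of_real (t\<^sup>2) - k * cnj k) * p"
    by (simp add: algebra_simps power2_eq_square)
  also have "\<dots> = 2 * complex_of_real D * p" by (simp add: kk D_def)
  finally show "ellipse_map \<delta> t (ellipse_coord \<delta> t p) = p" using D by (simp add: ellipse_map_def k_def)
  have "2 * (complex_of_real t * cnj (ellipse_map \<delta> t \<zeta>) - cnj k * ellipse_map \<delta> t \<zeta>)
      = (complex_of_real (t\<^sup>2) - k * cnj k) * \<zeta>"
    unfolding ellipse_map_def k_def[symmetric] by (simp add: field_simps power2_eq_square)
  also have "\<dots> = complex_of_real D * \<zeta>" by (simp add: kk D_def)
  finally show "ellipse_coord \<delta> t (ellipse_map \<delta> t \<zeta>) = \<zeta>"
    using D unfolding ellipse_coord_def k_def[symmetric] D_def[symmetric] by simp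
qed

lemma ellipse_map_scale: "ellipse_map \<delta> t (complex_of_real r * \<zeta>) = complex_of_real r * ellipse_map \<delta> t \<zeta>"
  by (simp add: ellipse_map_def algebra_simps add_divide_distrib)

lemma ellipse_coord_scale: "ellipse_coord \<delta> t (complex_of_real r * p) = complex_of_real r * ellipse_coord \<delta> t p"
  by (simp add: ellipse_coord_def algebra_simps diff_divide_distrib)

lemma ellipse_coord_sum: "ellipse_coord \<delta> t (\<Sum>j\<in>J. p j) = (\<Sum>j\<in>J. ellipse_coord \<delta> t (p j))"
proof (induction J rule: infinite_finite_induct)
  case (insert j J)
  have "ellipse_coord \<delta> t (p + q) = ellipse_coord \<delta> t p + ellipse_coord \<delta> t q" for p q
    by (simp add: ellipse_coord_def algebra_simps add_divide_distrib diff_divide_distrib)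
  then show ?case using insert by simp
qed (simp_all add: ellipse_coord_def)

text \<open>
  With \<open>\<zeta> = h\<^sup>2\<close>, \<open>a = \<surd>t h\<^bsup>*\<^esup>\<close> and \<open>b = (\<sigma>/\<surd>t) h\<close>, the point is \<open>(a\<^sup>2 + b\<^sup>2)/2\<close> and \<open>\<sigma> = a b\<close>. So the
  differences to the foci are \<open>(a - b)\<^sup>2/2\<close> and \<open>(a + b)\<^sup>2/2\<close>, and the parallelogram law applies.
\<close>

lemma focal_sum_ellipse_boundary:
  assumes t: "t > 0" and z: "cmod \<zeta> = 1"
  shows "focal_sum \<sigma> (ellipse_map (\<sigma>\<^sup>2) t \<zeta>) = t + cmod (\<sigma>\<^sup>2) / t"
proof -
  define h where "h = csqrt \<zeta>"
  define r where "r = complex_of_real (sqrt t)"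
  define a where "a = r * cnj h"
  define b where "b = \<sigma> / r * h"
  have r: "r \<noteq> 0" "r\<^sup>2 = complex_of_real t" using t by (auto simp: r_def simp flip: of_real_power)
  have hh: "h\<^sup>2 = \<zeta>" by (simp add: h_def)
  then have "(cmod h)\<^sup>2 = 1" using z by (simp flip: norm_power)
  then have ch: "cmod h = 1" by (simp add: power2_eq_1_iff) (smt (verit) norm_ge_zero)
  have "h * cnj h = 1" using complex_norm_square[of h] ch by simp
  then have ab: "a * b = \<sigma>" using r by (simp add: a_def b_def field_simps)
  have a2: "a\<^sup>2 = complex_of_real t * cnj \<zeta>" by (simp add: a_def power_mult_distrib r hh flip: complex_cnj_power)
  have b2: "b\<^sup>2 = \<sigma>\<^sup>2 / complex_of_real t * \<zeta>" by (simp add: b_def power_mult_distrib power_divide r hh)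
  have p: "ellipse_map (\<sigma>\<^sup>2) t \<zeta> = (a\<^sup>2 + b\<^sup>2) / 2" by (simp add: ellipse_map_def a2 b2)
  have "(a\<^sup>2 + b\<^sup>2) / 2 - \<sigma> = (a - b)\<^sup>2 / 2" "(a\<^sup>2 + b\<^sup>2) / 2 + \<sigma> = (a + b)\<^sup>2 / 2"
    unfolding ab[symmetric] by (simp_all add: field_simps power2_eq_square)
  then have "focal_sum \<sigma> (ellipse_map (\<sigma>\<^sup>2) t \<zeta>) = ((cmod (a - b))\<^sup>2 + (cmod (a + b))\<^sup>2) / 2"
    by (simp only: focal_sum_def p norm_divide norm_power) (simp add: add_divide_distrib)
  also have "\<dots> = (cmod a)\<^sup>2 + (cmod b)\<^sup>2"
    by (simp add: cmod_power2) (simp add: power2_eq_square algebra_simps)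
  also have "(cmod a)\<^sup>2 = t" using t ch by (simp add: a_def r_def norm_mult)
  also have "(cmod b)\<^sup>2 = cmod (\<sigma>\<^sup>2) / t"
    using t ch by (simp add: b_def r_def norm_mult norm_divide norm_power power_divide)
  finally show ?thesis .
qed

text \<open>Convexity of the focal sum, between \<open>p\<close> and \<open>0\<close>.\<close>

lemma focal_sum_scale_le:
  assumes "0 \<le> r" "r \<le> 1"
  shows "focal_sum \<sigma> (complex_of_real r * p) \<le> r * focal_sum \<sigma> p + (1 - r) * (2 * cmod \<sigma>)"
proof -
  have "complex_of_real r * p - \<sigma> = complex_of_real r * (p - \<sigma>) - complex_of_real (1 - r) * \<sigma>"
    "complex_of_real r * p + \<sigma> = complex_of_real r * (p + \<sigma>) + complex_of_real (1 - r) * \<sigma>"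
    by (simp_all add: algebra_simps)
  moreover have "cmod (complex_of_real r * (p - \<sigma>) - complex_of_real (1 - r) * \<sigma>)
      \<le> r * cmod (p - \<sigma>) + (1 - r) * cmod \<sigma>"
    using assms by (intro order_trans[OF norm_triangle_ineq4]) (simp add: norm_mult del: of_real_diff)
  moreover have "cmod (complex_of_real r * (p + \<sigma>) + complex_of_real (1 - r) * \<sigma>)
      \<le> r * cmod (p + \<sigma>) + (1 - r) * cmod \<sigma>"
    using assms by (intro order_trans[OF norm_triangle_ineq]) (simp add: norm_mult del: of_real_diff)
  ultimately show ?thesis by (simp add: focal_sum_def algebra_simps)
qed

text \<open>
  On a ray from the origin the focal sum is convex, equals \<open>2\<bar>\<sigma>\<bar>\<close> at the origin and the larger value
  \<open>t + \<bar>\<sigma>\<bar>\<^sup>2/t\<close> at the boundary point, so it is smaller before that point and larger after it.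
\<close>

lemma focal_sum_ellipse_map:
  assumes t: "cmod \<sigma> < t"
  shows "focal_sum \<sigma> (ellipse_map (\<sigma>\<^sup>2) t \<zeta>) < t + cmod (\<sigma>\<^sup>2) / t \<longleftrightarrow> cmod \<zeta> < 1" (is "?F \<zeta> < ?a \<longleftrightarrow> _")
    and "focal_sum \<sigma> (ellipse_map (\<sigma>\<^sup>2) t \<zeta>) \<le> t + cmod (\<sigma>\<^sup>2) / t \<longleftrightarrow> cmod \<zeta> \<le> 1"
proof -
  have t0: "t > 0" using t by (smt (verit) norm_ge_zero)
  have "0 < (t - cmod \<sigma>)\<^sup>2 / t" using t t0 by simp
  also have "(t - cmod \<sigma>)\<^sup>2 / t = ?a - 2 * cmod \<sigma>"
    using t0 by (simp add: power2_eq_square field_simps norm_mult)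
  finally have a: "2 * cmod \<sigma> < ?a" by simp
  have convex: "r * ?a + (1 - r) * ?a = ?a" for r by (simp only: flip: distrib_right) simp
  have lt: "?F \<zeta> < ?a" if "cmod \<zeta> < 1"
  proof (cases "\<zeta> = 0")
    case True
    then show ?thesis using a by (simp add: focal_sum_def ellipse_map_def)
  next
    case False
    define \<xi> where "\<xi> = \<zeta> / complex_of_real (cmod \<zeta>)"
    have "cmod \<xi> = 1" "\<zeta> = complex_of_real (cmod \<zeta>) * \<xi>" using False by (auto simp: \<xi>_def norm_divide)
    then have "?F \<zeta> \<le> cmod \<zeta> * ?a + (1 - cmod \<zeta>) * (2 * cmod \<sigma>)"
      using focal_sum_scale_le[of "cmod \<zeta>" \<sigma> "ellipse_map (\<sigma>\<^sup>2) t \<xi>"] that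
      by (simp add: focal_sum_ellipse_boundary[OF t0] flip: ellipse_map_scale)
    also have "\<dots> < cmod \<zeta> * ?a + (1 - cmod \<zeta>) * ?a"
      using a that by (intro add_strict_left_mono mult_strict_left_mono) auto
    finally show ?thesis unfolding convex .
  qed
  have eq: "?F \<zeta> = ?a" if "cmod \<zeta> = 1" using focal_sum_ellipse_boundary[OF t0 that] .
  have gt: "?F \<zeta> > ?a" if z: "cmod \<zeta> > 1"
  proof -
    let ?r = "1 / cmod \<zeta>"
    define \<xi> where "\<xi> = complex_of_real ?r * \<zeta>"
    have r: "0 < ?r" "?r < 1" using z by (auto simp: divide_less_eq)
    have "cmod \<xi> = 1" using z by (auto simp: \<xi>_def norm_divide)
    then have "?a \<le> ?r * ?F \<zeta> + (1 - ?r) * (2 * cmod \<sigma>)"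
      using focal_sum_scale_le[of ?r \<sigma> "ellipse_map (\<sigma>\<^sup>2) t \<zeta>"] r
      by (simp only: focal_sum_ellipse_boundary[OF t0] \<xi>_def less_imp_le flip: ellipse_map_scale)
    also have "\<dots> < ?r * ?F \<zeta> + (1 - ?r) * ?a"
      using a r by (intro add_strict_left_mono mult_strict_left_mono) auto
    finally have "?r * ?a < ?r * ?F \<zeta>" using convex[of ?r] by linarith
    then show ?thesis by (rule mult_left_less_imp_less) (use r in simp)
  qed
  show "?F \<zeta> < ?a \<longleftrightarrow> cmod \<zeta> < 1"
    using lt eq gt by (cases "cmod \<zeta>" "1 :: real" rule: linorder_cases) auto
  show "?F \<zeta> \<le> ?a \<longleftrightarrow> cmod \<zeta> \<le> 1"
    using lt eq gt by (cases "cmod \<zeta>" "1 :: real" rule: linorder_cases) auto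
qed

text \<open>
  Confocal ellipses are nested: a larger norm on the plane gives a larger disc.
\<close>

lemma major_axis_mono:
  assumes "0 < t" "d \<le> t\<^sup>2" "t \<le> u"
  shows "t + d / t \<le> u + d / (u :: real)"
proof -
  have "d \<le> t * u" using assms by (smt (verit) mult_left_mono power2_eq_square)
  then have "0 \<le> (u - t) * (1 - d / (t * u))" using assms by (intro mult_nonneg_nonneg) (auto simp: divide_le_eq)
  also have "\<dots> = (u + d / u) - (t + d / t)" using assms by (simp add: field_simps)
  finally show ?thesis by simp
qed

section \<open>Values taken on exchanged pairs\<close>

text \<open>
  The choice \<open>\<bar>a\<bar>\<^sup>2 = (1 + h)/2\<close> and \<open>\<bar>b\<bar>\<^sup>2 = (1 - h)/2\<close> is forced, up to exchanging \<open>a\<close> and \<open>b\<close>, by the norm and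
  the modulus of the product, where \<open>h = \<surd>(1 - \<bar>\<zeta>\<bar>\<^sup>2)\<close>.
\<close>

lemma half_disc_product:
  assumes "cmod \<zeta> \<le> 1"
  shows "\<exists>a b. (cmod a)\<^sup>2 + (cmod b)\<^sup>2 = 1 \<and> a * cnj b = cnj \<zeta> / 2"
proof -
  define h where "h = sqrt (1 - (cmod \<zeta>)\<^sup>2)"
  have "(cmod \<zeta>)\<^sup>2 \<le> 1" using assms by (simp add: power_le_one)
  then have h: "0 \<le> h" "(cmod \<zeta>)\<^sup>2 = 1 - h\<^sup>2" by (auto simp: h_def)
  define a where "a = sqrt ((1 + h) / 2)"
  have a: "a > 0" "a\<^sup>2 = (1 + h) / 2" using h by (auto simp: a_def)
  have "(cmod (\<zeta> / complex_of_real (2 * a)))\<^sup>2 = (1 - h\<^sup>2) / (4 * a\<^sup>2)"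
    using a by (simp add: norm_divide power_divide power_mult_distrib h norm_mult)
  also have "\<dots> = (1 - h) / 2" unfolding a(2) using h(1) by (simp add: field_simps power2_eq_square)
  finally have "(cmod (complex_of_real a))\<^sup>2 + (cmod (\<zeta> / complex_of_real (2 * a)))\<^sup>2 = 1"
    using a by (simp add: field_simps)
  moreover have "complex_of_real a * cnj (\<zeta> / complex_of_real (2 * a)) = cnj \<zeta> / 2"
    using a(1) by simp
  ultimately show ?thesis by blast
qed

text \<open>
  In each plane, \<open>zp\<close> has value \<open>p\<close> and the orthogonal unit vector \<open>zm\<close> has value \<open>-p\<close>. A positive and a
  negative entry of \<open>c\<close> may therefore share a plane, and two entries of the same sign are given different planes;
  so the number of planes is the larger of the numbers of positive and of negative entries.
\<close>

lemma c_numerical_range_exchanged_pairs: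
  fixes B :: "'a :: complex_inner \<Rightarrow> 'a"
  assumes B: "clinear B" and ex: "exchanged_pairs B \<delta> m x y t"
    and \<zeta>: "\<And>i. i < m \<Longrightarrow> cmod (\<zeta> i) \<le> 1" and p: "\<And>i. i < m \<Longrightarrow> ellipse_map \<delta> (t i) (\<zeta> i) = p"
    and c: "\<forall>r\<in>set c. r \<noteq> 0"
    and pos: "card {j. j < length c \<and> c ! j > 0} \<le> m" and neg: "card {j. j < length c \<and> c ! j < 0} \<le> m"
  shows "complex_of_real (\<Sum>j<length c. \<bar>c ! j\<bar>) * p \<in> c_numerical_range c B"
proof -
  have "\<forall>i. \<exists>a b. i < m \<longrightarrow> (cmod a)\<^sup>2 + (cmod b)\<^sup>2 = 1 \<and> a * cnj b = cnj (\<zeta> i) / 2"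
    using half_disc_product[OF \<zeta>] by blast
  then obtain a b where ab: "\<And>i. i < m \<Longrightarrow> (cmod (a i))\<^sup>2 + (cmod (b i))\<^sup>2 = 1"
      "\<And>i. i < m \<Longrightarrow> a i * cnj (b i) = cnj (\<zeta> i) / 2" by metis
  have ab2: "cnj (a i) * b i = \<zeta> i / 2" if "i < m" for i
    using arg_cong[OF ab(2)[OF that], of cnj] by simp
  have ab1: "a i * cnj (a i) + b i * cnj (b i) = 1" if "i < m" for i
    using arg_cong[OF ab(1)[OF that], of complex_of_real] by (simp only: complex_norm_square of_real_add of_real_1)
  define v where "v i p q = p *\<^sub>C x i + q *\<^sub>C y i" for i p q
  have vv: "cinner (v i p q) (v j p' q') = (if i = j then p * cnj p' + q * cnj q' else 0)"
    if "i < m" "j < m" for i j p q p' q'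
  proof -
    have "cinner (x i) (x j) = (if i = j then 1 else 0)" "cinner (y i) (y j) = (if i = j then 1 else 0)"
      "cinner (x i) (y j) = 0" "cinner (y i) (x j) = 0"
      using ex that by (auto simp: exchanged_pairs_def orthonormal_on_def intro: cinner_zero_commute)
    then show ?thesis
      by (simp add: v_def cinner_add_left cinner_add_right cinner_scaleC_left cinner_scaleC_right)
  qed
  have Bv: "B (v i p q) = v i (q * (\<delta> / complex_of_real (t i))) (p * complex_of_real (t i))" if "i < m" for i p q
    using ex that
    by (simp add: v_def exchanged_pairs_def clinear_add[OF B] clinear_scaleC[OF B] scaleC_scaleC add.commute)
  define zp where "zp i = v i (a i) (b i)" for i
  define zm where "zm i = v i (cnj (b i)) (- cnj (a i))" for i
  have val: "cinner (B (zp i)) (zp i) = p" "cinner (B (zm i)) (zm i) = - p" if i: "i < m" for i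
  proof -
    have "cinner (B (zp i)) (zp i) = (\<delta> / complex_of_real (t i)) * (cnj (a i) * b i) + complex_of_real (t i) * (a i * cnj (b i))"
      using i by (simp add: zp_def Bv vv ac_simps)
    then show 1: "cinner (B (zp i)) (zp i) = p"
      unfolding p[OF i, symmetric] ab(2)[OF i] ab2[OF i] by (simp add: ellipse_map_def algebra_simps add_divide_distrib)
    have "cinner (B (zm i)) (zm i) = - cinner (B (zp i)) (zp i)"
      using i by (simp add: zp_def zm_def Bv vv algebra_simps)
    then show "cinner (B (zm i)) (zm i) = - p" using 1 by simp
  qed
  have "\<exists>h. inj_on h {j. j < length c \<and> c ! j > 0} \<and> h ` {j. j < length c \<and> c ! j > 0} \<subseteq> {..<m}"
    using pos by (subst inj_on_iff_card_le) auto
  then obtain h where h: "inj_on h {j. j < length c \<and> c ! j > 0}"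
    "\<And>j. j < length c \<Longrightarrow> c ! j > 0 \<Longrightarrow> h j < m" by (auto simp: image_subset_iff)
  have "\<exists>h. inj_on h {j. j < length c \<and> c ! j < 0} \<and> h ` {j. j < length c \<and> c ! j < 0} \<subseteq> {..<m}"
    using neg by (subst inj_on_iff_card_le) auto
  then obtain k where k: "inj_on k {j. j < length c \<and> c ! j < 0}"
    "\<And>j. j < length c \<Longrightarrow> c ! j < 0 \<Longrightarrow> k j < m" by (auto simp: image_subset_iff)
  have cnz: "c ! j < 0 \<longleftrightarrow> \<not> c ! j > 0" if "j < length c" for j
    using c nth_mem[OF that] by (metis less_asym linorder_neqE_linordered_idom)
  define X where "X j = (if c ! j > 0 then zp (h j) else zm (k j))" for j
  have orth: "cinner (X i) (X j) = (if i = j then 1 else 0)" if ij: "i < length c" "j < length c" for i j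
  proof -
    have cross: "cinner (zp i) (zm j) = 0" "cinner (zm i) (zp j) = 0" if "i < m" "j < m" for i j
      using that by (auto simp: zp_def zm_def vv)
    have same: "cinner (zp i) (zp j) = (if i = j then 1 else 0)" "cinner (zm i) (zm j) = (if i = j then 1 else 0)"
      if "i < m" "j < m" for i j
      using that ab1[of j] by (auto simp: zp_def zm_def vv ac_simps)
    consider "c ! i > 0" "c ! j > 0" | "c ! i > 0" "c ! j < 0" | "c ! i < 0" "c ! j > 0" | "c ! i < 0" "c ! j < 0"
      using cnz ij by blast
    then show ?thesis
    proof cases
      case 1
      then have "h i = h j \<longleftrightarrow> i = j" using h(1) ij by (auto dest: inj_onD)
      then show ?thesis using 1 ij h(2) by (simp add: X_def same)
    next
      case 4
      then have "k i = k j \<longleftrightarrow> i = j" using k(1) ij by (auto dest: inj_onD)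
      then show ?thesis using 4 ij k(2) by (simp add: X_def same)
    qed (use ij h(2) k(2) in \<open>auto simp: X_def cross\<close>)
  qed
  have "(\<Sum>j<length c. complex_of_real (c ! j) * cinner (B (X j)) (X j))
      = (\<Sum>j<length c. complex_of_real \<bar>c ! j\<bar> * p)"
  proof (intro sum.cong refl)
    fix j assume "j \<in> {..<length c}"
    then have "j < length c" by simp
    then show "complex_of_real (c ! j) * cinner (B (X j)) (X j) = complex_of_real \<bar>c ! j\<bar> * p"
      using h(2)[of j] k(2)[of j] cnz[of j] by (cases "c ! j > 0") (auto simp: X_def val)
  qed
  then have "complex_of_real (\<Sum>j<length c. \<bar>c ! j\<bar>) * p
      = (\<Sum>j<length c. complex_of_real (c ! j) * cinner (B (X j)) (X j))"
    by (simp add: sum_distrib_right)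
  then show ?thesis unfolding c_numerical_range_def using orth by blast
qed

section \<open>Norming vectors and the boundary of the ellipse\<close>

lemma Re_of_real_mult: "Re (complex_of_real r * z) = r * Re z"
  by simp

text \<open>
  The choice \<open>\<bar>l\<bar> = 1/t\<close> for the coefficient \<open>l = cnj w / t\<close> makes the terms with \<open>\<parallel>Bx\<parallel>\<^sup>2\<close> cancel,
  so that only \<open>\<langle>Bx, x\<rangle>\<close> remains, and it enters through its coordinate \<open>\<zeta>\<close>.
\<close>

lemma defect_identity:
  fixes B :: "'a :: complex_inner \<Rightarrow> 'a"
  assumes B: "clinear B" and sq: "\<And>x. B (B x) = \<delta> *\<^sub>C x" and x: "norm x = 1"
    and t: "t > 0" and w: "cmod w = 1" and z: "cinner (B x) x = ellipse_map \<delta> t \<zeta>"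
  shows "t\<^sup>2 * (norm (x + (cnj w / complex_of_real t) *\<^sub>C B x))\<^sup>2
      - (norm (B (x + (cnj w / complex_of_real t) *\<^sub>C B x)))\<^sup>2
      = (t\<^sup>2 - (cmod \<delta> / t)\<^sup>2) * (1 + Re (w * \<zeta>))"
proof -
  define l where "l = cnj w / complex_of_real t"
  define k where "k = \<delta> / complex_of_real t"
  define z where "z = cinner (B x) x"
  have l: "(cmod l)\<^sup>2 = 1 / t\<^sup>2" using w t by (simp add: l_def norm_divide power_divide)
  have kd: "(cmod (l * \<delta>))\<^sup>2 = (cmod \<delta> / t)\<^sup>2"
    using w t by (simp add: l_def norm_mult norm_divide power_divide)
  have v: "(norm (x + l *\<^sub>C B x))\<^sup>2 = 1 + (norm (B x))\<^sup>2 / t\<^sup>2 + 2 * Re (l * z)"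
    by (simp add: norm_add_scaleC_sq x l z_def)
  have "B (x + l *\<^sub>C B x) = B x + (l * \<delta>) *\<^sub>C x"
    by (simp add: clinear_add[OF B] clinear_scaleC[OF B] sq scaleC_scaleC)
  then have "(norm (B (x + l *\<^sub>C B x)))\<^sup>2 = (norm (B x))\<^sup>2 + (cmod \<delta> / t)\<^sup>2 + 2 * Re (l * \<delta> * cnj z)"
    by (simp add: norm_add_scaleC_sq x kd z_def cinner_commute[symmetric])
  then have "t\<^sup>2 * (norm (x + l *\<^sub>C B x))\<^sup>2 - (norm (B (x + l *\<^sub>C B x)))\<^sup>2
      = t\<^sup>2 - (cmod \<delta> / t)\<^sup>2 + (2 * t\<^sup>2 * Re (l * z) - 2 * Re (l * \<delta> * cnj z))"
    using t by (simp add: v field_simps)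
  also have "2 * t\<^sup>2 * Re (l * z) - 2 * Re (l * \<delta> * cnj z)
      = Re (cnj w * (2 * (complex_of_real t * z - k * cnj z)))"
  proof -
    have "complex_of_real (t\<^sup>2) * (l * z) - l * \<delta> * cnj z = cnj w * (complex_of_real t * z - k * cnj z)"
      using t by (simp add: l_def k_def field_simps power2_eq_square)
    then have "Re (complex_of_real (t\<^sup>2) * (l * z) - l * \<delta> * cnj z)
        = Re (cnj w * (complex_of_real t * z - k * cnj z))" by simp
    then have "t\<^sup>2 * Re (l * z) - Re (l * \<delta> * cnj z) = Re (cnj w * (complex_of_real t * z - k * cnj z))"
      unfolding minus_complex.sel(1) Re_of_real_mult .
    moreover have "cnj w * (2 * (complex_of_real t * z - k * cnj z))
        = complex_of_real 2 * (cnj w * (complex_of_real t * z - k * cnj z))" by simp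
    then have "Re (cnj w * (2 * (complex_of_real t * z - k * cnj z)))
        = 2 * Re (cnj w * (complex_of_real t * z - k * cnj z))" by (simp only: Re_of_real_mult)
    ultimately show ?thesis by simp
  qed
  also have "2 * (complex_of_real t * z - k * cnj z)
      = complex_of_real (t\<^sup>2 - (cmod \<delta> / t)\<^sup>2) * cnj \<zeta>"
  proof -
    have kk: "k * cnj k = complex_of_real ((cmod \<delta> / t)\<^sup>2)"
      using complex_norm_square[of k] t by (simp add: k_def norm_divide)
    have "2 * (complex_of_real t * z - k * cnj z)
      = complex_of_real t * (complex_of_real t * cnj \<zeta> + k * \<zeta>) - k * (complex_of_real t * \<zeta> + cnj k * cnj \<zeta>)"
      unfolding z_def assms(6) ellipse_map_def k_def[symmetric] by (simp add: field_simps)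
    also have "\<dots> = (complex_of_real (t\<^sup>2) - k * cnj k) * cnj \<zeta>"
      by (simp add: algebra_simps power2_eq_square)
    finally show ?thesis by (simp add: kk)
  qed
  also have "cnj w * (complex_of_real (t\<^sup>2 - (cmod \<delta> / t)\<^sup>2) * cnj \<zeta>)
      = complex_of_real (t\<^sup>2 - (cmod \<delta> / t)\<^sup>2) * cnj (w * \<zeta>)"
    by (simp add: ac_simps)
  also have "Re \<dots> = (t\<^sup>2 - (cmod \<delta> / t)\<^sup>2) * Re (w * \<zeta>)"
    by (simp only: Re_of_real_mult cnj.sel)
  finally show ?thesis by (simp add: l_def algebra_simps)
qed

lemma maximal_vectors_subspace:
  fixes B :: "'a :: complex_inner \<Rightarrow> 'a"
  assumes B: "clinear B" and le: "\<And>x. norm (B x) \<le> t * norm x" and t: "t \<ge> 0"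
  shows "complex_vector.subspace {x. norm (B x) = t * norm x}"
  unfolding complex_vector.subspace_def
proof (intro conjI ballI allI)
  show "0 \<in> {x. norm (B x) = t * norm x}" by (simp add: clinear_zero[OF B])
  fix x y assume "x \<in> {x. norm (B x) = t * norm x}" "y \<in> {x. norm (B x) = t * norm x}"
  then have xy: "norm (B x) = t * norm x" "norm (B y) = t * norm y" by auto
  have "cinner (B y) (B x) = complex_of_real (t\<^sup>2) * cinner y x"
    by (rule cinner_image_at_maximal_vector[OF B xy(2) le t])
  then have "(norm (B x + 1 *\<^sub>C B y))\<^sup>2 = t\<^sup>2 * (norm (x + 1 *\<^sub>C y))\<^sup>2"
    unfolding norm_add_scaleC_sq xy by (simp add: algebra_simps power_mult_distrib)
  then have "(norm (B (x + y)))\<^sup>2 = (t * norm (x + y))\<^sup>2"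
    by (simp add: scaleC_one clinear_add[OF B] power_mult_distrib)
  then show "x + y \<in> {x. norm (B x) = t * norm x}" using t by (simp add: power2_eq_iff_nonneg)
next
  fix a x assume "x \<in> {x. norm (B x) = t * norm x}"
  then show "a *\<^sub>C x \<in> {x. norm (B x) = t * norm x}"
    by (simp add: clinear_scaleC[OF B] norm_scaleC)
qed

text \<open>
  Let \<open>z j\<close> be the coordinate of \<open>\<langle>B x\<^sub>j, x\<^sub>j\<rangle>\<close>. By linearity \<open>\<zeta>\<close> is the average of the \<open>sgn c\<^sub>j z j\<close> with
  weights proportional to \<open>\<bar>c\<^sub>j\<bar>\<close>, and each \<open>z j\<close> is in the unit disc by the defect identity. If the
  average is on the unit circle, then all \<open>sgn c\<^sub>j z j\<close> are equal to it, and the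
  defect of the corresponding vectors is zero.
\<close>

lemma c_numerical_range_boundary:
  fixes B :: "'a :: complex_inner \<Rightarrow> 'a"
  assumes B: "clinear B" and sq: "\<And>x. B (B x) = \<delta> *\<^sub>C x" and le: "\<And>x. norm (B x) \<le> t * norm x"
    and t: "t > 0" "cmod \<delta> < t\<^sup>2"
    and x: "orthonormal_on {..<length c} x" and c: "\<forall>r\<in>set c. r \<noteq> 0" "c \<noteq> []"
    and p: "(\<Sum>j<length c. complex_of_real (c ! j) * cinner (B (x j)) (x j))
        = complex_of_real (\<Sum>j<length c. \<bar>c ! j\<bar>) * ellipse_map \<delta> t \<zeta>"
  shows "cmod \<zeta> \<le> 1"
    and "cmod \<zeta> = 1 \<Longrightarrow> j < length c \<Longrightarrow>
      norm (B (x j - (complex_of_real (sgn (c ! j)) * \<zeta> / complex_of_real t) *\<^sub>C B (x j)))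
        = t * norm (x j - (complex_of_real (sgn (c ! j)) * \<zeta> / complex_of_real t) *\<^sub>C B (x j))"
proof -
  let ?C = "\<Sum>j<length c. \<bar>c ! j\<bar>"
  define z where "z j = ellipse_coord \<delta> t (cinner (B (x j)) (x j))" for j
  have zm: "cinner (B (x j)) (x j) = ellipse_map \<delta> t (z j)" for j
    by (simp add: z_def ellipse_map_coord[OF t])
  define D where "D = t\<^sup>2 - (cmod \<delta> / t)\<^sup>2"
  have D: "D > 0" unfolding D_def by (rule ellipse_coord_denominator_pos[OF t])
  have cnz: "c ! j \<noteq> 0" if "j < length c" for j using c(1) nth_mem[OF that] by blast
  have "0 < \<bar>c ! 0\<bar>" using cnz[of 0] c(2) by simp
  also have "\<dots> \<le> ?C" using c(2) by (intro member_le_sum) auto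
  finally have C: "?C > 0" .
  have "ellipse_coord \<delta> t (complex_of_real ?C * ellipse_map \<delta> t \<zeta>)
      = (\<Sum>j<length c. complex_of_real (c ! j) * z j)"
    by (simp only: p[symmetric] ellipse_coord_sum ellipse_coord_scale z_def)
  then have sum: "complex_of_real ?C * \<zeta> = (\<Sum>j<length c. complex_of_real (c ! j) * z j)"
    by (simp only: ellipse_coord_scale ellipse_coord_map[OF t])
  have bound: "\<bar>Re (w * z j)\<bar> \<le> 1" if w: "cmod w = 1" and j: "j < length c" for w j
  proof -
    have nx: "norm (x j) = 1" using orthonormal_on_norm[OF x] j by simp
    have "0 \<le> 1 + Re (w' * z j)" if "cmod w' = 1" for w'
    proof -
      let ?v = "x j + (cnj w' / complex_of_real t) *\<^sub>C B (x j)"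
      have "(norm (B ?v))\<^sup>2 \<le> t\<^sup>2 * (norm ?v)\<^sup>2"
        using le[of ?v] by (metis norm_ge_zero power_mono power_mult_distrib)
      then have "0 \<le> D * (1 + Re (w' * z j))"
        using defect_identity[OF B sq nx t(1) that zm] by (simp add: D_def)
      then show ?thesis using D by (simp add: zero_le_mult_iff)
    qed
    from this[of w] this[of "- w"] w show ?thesis by (simp add: abs_le_iff)
  qed
  have resum: "?C * Re (w * \<zeta>) = (\<Sum>j<length c. c ! j * Re (w * z j))" for w
  proof -
    have "complex_of_real ?C * (w * \<zeta>) = w * (complex_of_real ?C * \<zeta>)" by (simp add: ac_simps)
    also have "\<dots> = (\<Sum>j<length c. complex_of_real (c ! j) * (w * z j))"
      unfolding sum sum_distrib_left by (simp add: ac_simps)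
    finally have "Re (complex_of_real ?C * (w * \<zeta>)) = (\<Sum>j<length c. Re (complex_of_real (c ! j) * (w * z j)))"
      by (simp only: Re_sum)
    then show ?thesis by (simp only: Re_of_real_mult)
  qed
  have term_le: "c ! j * Re (w * z j) \<le> \<bar>c ! j\<bar>" if "cmod w = 1" "j < length c" for w j
    using mult_left_mono[OF bound[OF that], of "\<bar>c ! j\<bar>"] abs_ge_self[of "c ! j * Re (w * z j)"]
    by (simp add: abs_mult)
  show "cmod \<zeta> \<le> 1"
  proof (cases "\<zeta> = 0")
    case False
    define w where "w = cnj \<zeta> / complex_of_real (cmod \<zeta>)"
    have w: "cmod w = 1" using False by (simp add: w_def norm_divide)
    have "w * \<zeta> = complex_of_real (cmod \<zeta>)"
      using False complex_norm_square[of \<zeta>]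
      by (simp add: w_def power2_eq_square ac_simps flip: of_real_mult) (simp add: field_simps power2_eq_square)
    then have "?C * cmod \<zeta> = (\<Sum>j<length c. c ! j * Re (w * z j))" using resum[of w] by simp
    also have "\<dots> \<le> ?C" using term_le[OF w] by (intro sum_mono) auto
    finally show ?thesis using C by simp
  qed simp
  assume z1: "cmod \<zeta> = 1" and j: "j < length c"
  define w where "w = cnj \<zeta>"
  have w: "cmod w = 1" using z1 by (simp add: w_def)
  have "w * \<zeta> = 1" using complex_norm_square[of \<zeta>] z1 by (simp add: w_def mult.commute)
  then have "?C = (\<Sum>j<length c. c ! j * Re (w * z j))" using resum[of w] by simp
  then have "(\<Sum>j<length c. \<bar>c ! j\<bar> - c ! j * Re (w * z j)) = 0" by (simp add: sum_subtractf)
  then have "\<bar>c ! j\<bar> - c ! j * Re (w * z j) = 0"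
    using j term_le[OF w] by (subst (asm) sum_nonneg_eq_0_iff) auto
  then have "c ! j * (sgn (c ! j) - Re (w * z j)) = 0"
    by (simp only: abs_sgn right_diff_distrib)
  then have "Re (w * z j) = sgn (c ! j)" using cnz[OF j] by (simp only: mult_eq_0_iff) simp
  moreover have "sgn (c ! j) * sgn (c ! j) = 1" using cnz[OF j] by (simp add: sgn_if)
  ultimately have "sgn (c ! j) * Re (w * z j) = 1" by (simp only:)
  then have re: "1 + Re (- complex_of_real (sgn (c ! j)) * w * z j) = 0"
    by (simp add: mult.assoc Re_of_real_mult del: times_complex.sel)
  have nx: "norm (x j) = 1" using orthonormal_on_norm[OF x] j by simp
  have sg: "cmod (- complex_of_real (sgn (c ! j)) * w) = 1"
    using cnz[OF j] w by (simp add: norm_mult abs_sgn_eq)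
  define v where "v = x j - (complex_of_real (sgn (c ! j)) * \<zeta> / complex_of_real t) *\<^sub>C B (x j)"
  have "v = x j + (cnj (- complex_of_real (sgn (c ! j)) * w) / complex_of_real t) *\<^sub>C B (x j)"
    by (simp add: v_def w_def complex_vector.scale_minus_left)
  then have "t\<^sup>2 * (norm v)\<^sup>2 - (norm (B v))\<^sup>2 = 0"
    using defect_identity[OF B sq nx t(1) sg zm] by (simp only: re mult_zero_right)
  then have "(norm (B v))\<^sup>2 = (t * norm v)\<^sup>2" by (simp add: power_mult_distrib)
  then have "norm (B v) = t * norm v" using t(1) by (simp add: power2_eq_iff_nonneg)
  then show "norm (B (x j - (complex_of_real (sgn (c ! j)) * \<zeta> / complex_of_real t) *\<^sub>C B (x j)))
        = t * norm (x j - (complex_of_real (sgn (c ! j)) * \<zeta> / complex_of_real t) *\<^sub>C B (x j))"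
    by (simp add: v_def)
qed

text \<open>
  The kernel of \<open>v \<mapsto> v - l Bv\<close> is trivial: on it \<open>Bv = v/l\<close>, whence \<open>\<bar>\<delta>\<bar> = 1/\<bar>l\<bar>\<^sup>2 = t\<^sup>2\<close> unless \<open>v = 0\<close>.
  So an orthonormal family is carried to an independent one.
\<close>

lemma independent_maximal_vectors:
  fixes B :: "'a :: complex_inner \<Rightarrow> 'a"
  assumes B: "clinear B" and sq: "\<And>x. B (B x) = \<delta> *\<^sub>C x" and le: "\<And>x. norm (B x) \<le> t * norm x"
    and t: "t > 0" "cmod \<delta> < t\<^sup>2"
    and x: "finite J" "orthonormal_on J x" and l: "cmod l = 1 / t"
    and max: "\<And>j. j \<in> J \<Longrightarrow> norm (B (x j - l *\<^sub>C B (x j))) = t * norm (x j - l *\<^sub>C B (x j))"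
  shows "\<exists>L. complex_vector.subspace L \<and> cdim_at_least (card J) L \<and> (\<forall>v\<in>L. norm (B v) = t * norm v)"
proof -
  interpret pair: vector_space_pair "scaleC :: complex \<Rightarrow> 'a \<Rightarrow> 'a" "scaleC :: complex \<Rightarrow> 'a \<Rightarrow> 'a" ..
  define F where "F v = v - l *\<^sub>C B v" for v
  have F: "clinear F"
    by (rule clinearI) (auto simp: F_def clinear_add[OF B] clinear_scaleC[OF B] scaleC_add_right
        complex_vector.scale_right_diff_distrib scaleC_scaleC mult.commute)
  have "v = 0" if "F v = 0" for v
  proof -
    have v: "v = l *\<^sub>C B v" using that by (simp add: F_def)
    then have "B v = (l * \<delta>) *\<^sub>C v"
      by (metis clinear_scaleC[OF B] sq scaleC_scaleC)
    then have "norm (B v) = cmod \<delta> / t * norm v" by (simp add: norm_scaleC norm_mult l)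
    moreover have "norm v = norm (B v) / t" using arg_cong[OF v, of norm] by (simp add: norm_scaleC l)
    ultimately have "norm v = cmod \<delta> / t * norm v / t" by simp
    then have "norm v * (t\<^sup>2 - cmod \<delta>) = 0" using t(1) by (simp add: field_simps power2_eq_square)
    then show ?thesis using t(2) by simp
  qed
  then have inj: "inj F" by (intro injI) (metis clinear_diff[OF F] eq_iff_diff_eq_0)
  have "complex_vector.independent (F ` x ` J)"
    by (rule pair.linear_independent_injective_image[OF F[unfolded clinear_def]
          orthonormal_on_independent(2)[OF x]]) (rule inj_on_subset[OF inj subset_UNIV])
  then have "complex_vector.dim (complex_vector.span (F ` x ` J)) = card (F ` x ` J)"
    by (rule complex_vector.dim_span_eq_card_independent)
  also have "\<dots> = card J"
    using inj orthonormal_on_independent(1)[OF x]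
    by (simp add: card_image inj_on_subset)
  finally have "cdim_at_least (card J) (complex_vector.span (F ` x ` J))" by (simp add: cdim_at_least_def)
  moreover have "complex_vector.span (F ` x ` J) \<subseteq> {v. norm (B v) = t * norm v}"
    by (rule complex_vector.span_minimal[OF _ maximal_vectors_subspace[OF B le]])
      (use max t in \<open>auto simp: F_def\<close>)
  ultimately show ?thesis using complex_vector.subspace_span by blast
qed

section \<open>Sources of exchanged pairs\<close>

lemma exchanged_pairs_from_maximal_subspace:
  fixes B :: "'a :: complex_inner \<Rightarrow> 'a"
  assumes B: "clinear B" and sq: "\<And>x. B (B x) = \<delta> *\<^sub>C x" and le: "\<And>x. norm (B x) \<le> t * norm x"
    and t: "t > 0" "cmod \<delta> < t\<^sup>2"
    and L: "complex_vector.subspace L" "cdim_at_least m L" "\<And>x. x \<in> L \<Longrightarrow> norm (B x) = t * norm x"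
  shows "\<exists>x y. exchanged_pairs B \<delta> m x y (\<lambda>_. t)"
proof -
  obtain x where x: "orthonormal_on {..<m} x" "\<forall>i<m. x i \<in> L"
    using orthonormal_in_subspace[OF L(1,2)] by blast
  define y where "y i = (1 / complex_of_real t) *\<^sub>C B (x i)" for i
  have crit: "cinner (B (x i)) (B v) = complex_of_real (t\<^sup>2) * cinner (x i) v" if "i < m" for i v
    using that x(2) t(1) by (intro cinner_image_at_maximal_vector[OF B L(3) le]) auto
  have "cinner (B (x j)) (x i) = 0" if "i < m" "j < m" for i j
    using that by (intro maximal_vector_images_orthogonal[OF sq t(2)] crit)
  then have "cinner (x i) (y j) = 0" if "i < m" "j < m" for i j
    using that by (simp add: y_def cinner_scaleC_right cinner_zero_commute)
  moreover have "orthonormal_on {..<m} y"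
    using x(1) t(1) by (auto simp: orthonormal_on_def y_def cinner_scaleC_left cinner_scaleC_right crit power2_eq_square)
  moreover have "B (x i) = complex_of_real t *\<^sub>C y i" "B (y i) = (\<delta> / complex_of_real t) *\<^sub>C x i" for i
    using t(1) by (simp_all add: y_def scaleC_scaleC scaleC_one clinear_scaleC[OF B] sq)
  ultimately show ?thesis using x(1) unfolding exchanged_pairs_def by blast
qed

text \<open>\<open>t\<^sup>2 \<parallel>x\<parallel> = \<parallel>B(Bx)\<parallel> \<le> t \<parallel>Bx\<parallel>\<close>.\<close>

lemma maximal_everywhere_if_critical:
  fixes B :: "'a :: complex_inner \<Rightarrow> 'a"
  assumes sq: "\<And>x. B (B x) = \<delta> *\<^sub>C x" and le: "\<And>x. norm (B x) \<le> t * norm x"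
    and t: "t \<ge> 0" "cmod \<delta> = t\<^sup>2"
  shows "norm (B x) = t * norm x"
proof (cases "t = 0")
  case True
  then show ?thesis using le[of x] by simp
next
  case False
  have "t * (t * norm x) \<le> t * norm (B x)"
    using le[of "B x"] by (simp add: sq norm_scaleC t(2) power2_eq_square ac_simps)
  then have "t * norm x \<le> norm (B x)" using False t(1) by simp
  then show ?thesis using le[of x] by simp
qed

text \<open>
  Here \<open>B/t\<close> is an isometry, so the two eigenspaces are orthogonal. For orthonormal families \<open>e\<close>
  and \<open>d\<close> in them, \<open>B\<close> exchanges \<open>e + d\<close> and \<open>e - d\<close> up to the factor \<open>\<sigma>\<close>.
\<close>

lemma exchanged_pairs_if_critical:
  fixes B :: "'a :: complex_inner \<Rightarrow> 'a"
  assumes B: "clinear B" and sq: "\<And>x. B (B x) = \<sigma>\<^sup>2 *\<^sub>C x"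
    and le: "\<And>x. norm (B x) \<le> t * norm x" and t: "t > 0" "cmod \<sigma> = t"
    and eig: "infinite_cdim (eigenspace B \<sigma>)" "infinite_cdim (eigenspace B (- \<sigma>))"
  shows "\<exists>x y. exchanged_pairs B (\<sigma>\<^sup>2) m x y (\<lambda>_. t)"
proof -
  have sub: "complex_vector.subspace (eigenspace B l)" for l
    unfolding complex_vector.subspace_def eigenspace_def
    by (auto simp: clinear_zero[OF B] clinear_add[OF B] clinear_scaleC[OF B] scaleC_add_right
        scaleC_scaleC mult.commute)
  obtain e where e: "orthonormal_on {..<m} e" "\<forall>i<m. e i \<in> eigenspace B \<sigma>"
    using orthonormal_in_subspace[OF sub, of m \<sigma>] eig(1) by (auto simp: cdim_at_least_def)
  obtain d where d: "orthonormal_on {..<m} d" "\<forall>i<m. d i \<in> eigenspace B (- \<sigma>)"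
    using orthonormal_in_subspace[OF sub, of m "- \<sigma>"] eig(2) by (auto simp: cdim_at_least_def)
  have Be: "B (e i) = \<sigma> *\<^sub>C e i" and Bd: "B (d i) = (- \<sigma>) *\<^sub>C d i" if "i < m" for i
    using e(2) d(2) that by (auto simp: eigenspace_def complex_vector.scale_minus_left add_eq_0_iff2)
  have "norm (B x) = t * norm x" for x
    using maximal_everywhere_if_critical[OF sq le] t by (simp add: norm_power)
  then have iso: "cinner (B u) (B v) = complex_of_real (t\<^sup>2) * cinner u v" for u v
    using t by (intro cinner_image_at_maximal_vector[OF B _ le]) auto
  have ss: "\<sigma> * cnj \<sigma> = complex_of_real (t\<^sup>2)" using complex_norm_square[of \<sigma>] t by simp
  have ed: "cinner (e i) (d j) = 0" if "i < m" "j < m" for i j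
  proof -
    have "cinner (B (e i)) (B (d j)) = - (\<sigma> * cnj \<sigma> * cinner (e i) (d j))"
      using that by (simp only: Be Bd cinner_scaleC_left cinner_scaleC_right) simp
    then have "complex_of_real (t\<^sup>2) * cinner (e i) (d j) = - (complex_of_real (t\<^sup>2) * cinner (e i) (d j))"
      by (simp only: iso ss)
    then show ?thesis using t(1) by simp
  qed
  note de = ed[THEN cinner_zero_commute]
  define r where "r = complex_of_real (1 / sqrt 2)"
  have r: "r * cnj r * 2 = 1" by (simp add: r_def flip: of_real_mult)
  define x where "x i = r *\<^sub>C (e i + d i)" for i
  define q where "q = \<sigma> / complex_of_real t * r"
  define y where "y i = q *\<^sub>C (e i - d i)" for i
  have "q * cnj q * 2 = (\<sigma> * cnj \<sigma>) / complex_of_real (t\<^sup>2) * (r * cnj r * 2)"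
    by (simp add: q_def power2_eq_square ac_simps)
  then have q: "q * cnj q * 2 = 1" using t(1) by (simp only: r ss) simp
  have ee: "cinner (e i + d i) (e j + d j) = (if i = j then 2 else 0)"
    "cinner (e i - d i) (e j - d j) = (if i = j then 2 else 0)"
    "cinner (e i + d i) (e j - d j) = 0" if "i < m" "j < m" for i j
    using that e(1) d(1)
    by (auto simp: orthonormal_on_def cinner_add_left cinner_add_right cinner_diff_left
        cinner_diff_right ed de)
  have cc: "cinner (a *\<^sub>C u) (b *\<^sub>C v) = a * cnj b * cinner u v" for a b and u v :: 'a
    by (simp add: cinner_scaleC_left cinner_scaleC_right)
  have "orthonormal_on {..<m} x" "orthonormal_on {..<m} y"
    unfolding orthonormal_on_def x_def y_def cc using q r by (auto simp: ee)
  moreover have "cinner (x i) (y j) = 0" if "i < m" "j < m" for i j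
    using that by (simp add: x_def y_def cc ee)
  moreover have "B (x i) = complex_of_real t *\<^sub>C y i" "B (y i) = (\<sigma>\<^sup>2 / complex_of_real t) *\<^sub>C x i" if "i < m" for i
  proof -
    have "B (e i + d i) = \<sigma> *\<^sub>C (e i - d i)" "B (e i - d i) = \<sigma> *\<^sub>C (e i + d i)"
      using that by (simp_all add: clinear_add[OF B] clinear_diff[OF B] Be Bd scaleC_add_right
          complex_vector.scale_right_diff_distrib complex_vector.scale_minus_left)
    then show "B (x i) = complex_of_real t *\<^sub>C y i" "B (y i) = (\<sigma>\<^sup>2 / complex_of_real t) *\<^sub>C x i"
      using t(1) by (simp_all add: x_def y_def q_def clinear_scaleC[OF B] scaleC_scaleC power2_eq_square mult.commute)
  qed
  ultimately show ?thesis unfolding exchanged_pairs_def by blast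
qed

lemma exchanged_pairs_zero:
  assumes "infinite_cdim (UNIV :: 'a :: complex_inner set)" and "\<And>x. B x = (0 :: 'a)"
  shows "\<exists>x y. exchanged_pairs B 0 m x y (\<lambda>_. 0)"
proof -
  obtain z :: "nat \<Rightarrow> 'a" where z: "orthonormal_on {..<2 * m} z"
    using orthonormal_in_subspace[OF complex_vector.subspace_UNIV, of "2 * m"] assms(1)
    by (auto simp: cdim_at_least_def)
  have "exchanged_pairs B 0 m z (\<lambda>i. z (m + i)) (\<lambda>_. 0)"
    using z by (auto simp: exchanged_pairs_def orthonormal_on_def assms(2))
  then show ?thesis by blast
qed

text \<open>
  \<open>B/\<sigma>\<close> is an isometric involution, hence self-adjoint, so its quadratic form is real and bounded
  by \<open>1\<close> on unit vectors.
\<close>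

lemma rayleigh_value_if_critical:
  fixes B :: "'a :: complex_inner \<Rightarrow> 'a"
  assumes B: "clinear B" and sq: "\<And>x. B (B x) = \<sigma>\<^sup>2 *\<^sub>C x"
    and le: "\<And>x. norm (B x) \<le> t * norm x" and t: "cmod \<sigma> = t" and x: "norm x = 1"
  shows "\<exists>q. \<bar>q\<bar> \<le> 1 \<and> cinner (B x) x = complex_of_real q * \<sigma>"
proof (cases "\<sigma> = 0")
  case True
  then have "B x = 0" using le[of x] t by simp
  then show ?thesis by (intro exI[of _ 0]) simp
next
  case False
  then have t0: "t > 0" using t by auto
  have max: "norm (B v) = t * norm v" for v
    using maximal_everywhere_if_critical[OF sq le] t by (auto simp: norm_power)
  define z where "z = cinner (B x) x"
  define q where "q = z / \<sigma>"
  have z: "z = q * \<sigma>" using False by (simp add: q_def)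
  have "cinner (B x) (B (B x)) = complex_of_real (t\<^sup>2) * cinner x (B x)"
    using t0 by (intro cinner_image_at_maximal_vector[OF B max le]) auto
  then have "cnj \<sigma> * cnj \<sigma> * z = \<sigma> * cnj \<sigma> * cnj z"
    using complex_norm_square[of \<sigma>] t
    by (simp add: sq cinner_scaleC_right z_def cinner_commute[symmetric] power2_eq_square)
  then have "q = cnj q" using False by (simp add: z)
  then have "Im q = Im (cnj q)" by (rule arg_cong)
  then have "Im q = 0" by simp
  then have q: "q = complex_of_real (Re q)" by (simp add: complex_eq_iff)
  have "cmod z \<le> t" using cmod_cinner_le_norm[OF x, of "B x"] max[of x] x by (simp add: z_def)
  then have "cmod q \<le> 1" using t0 t by (simp add: q_def norm_divide)
  then have "\<bar>Re q\<bar> \<le> 1" using abs_Re_le_cmod order_trans by blast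
  then show ?thesis using q z z_def by metis
qed

lemma image_setcompr_eq:
  assumes "\<And>x. P x \<Longrightarrow> F x = h (G x)"
  shows "{F x | x. P x} = h ` {G x | x. P x}"
  unfolding setcompr_eq_image image_image using assms by (intro image_cong) auto

lemma c_numerical_range_translate:
  fixes A :: "'a :: complex_inner \<Rightarrow> 'a"
  shows "c_numerical_range c A
    = (\<lambda>z. \<mu> * complex_of_real (\<Sum>j<length c. c ! j) + z) ` c_numerical_range c (\<lambda>x. A x - \<mu> *\<^sub>C x)"
  unfolding c_numerical_range_def
proof (rule image_setcompr_eq)
  show "(\<Sum>j<length c. complex_of_real (c ! j) * cinner (A (x j)) (x j))
      = \<mu> * complex_of_real (\<Sum>j<length c. c ! j)
        + (\<Sum>j<length c. complex_of_real (c ! j) * cinner (A (x j) - \<mu> *\<^sub>C x j) (x j))"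
    if "\<forall>i<length c. \<forall>j<length c. cinner (x i) (x j) = (if i = j then 1 else 0)" for x :: "nat \<Rightarrow> 'a"
  proof -
    have "(\<Sum>j<length c. complex_of_real (c ! j) * cinner (A (x j)) (x j))
      = (\<Sum>j<length c. \<mu> * complex_of_real (c ! j)
          + complex_of_real (c ! j) * cinner (A (x j) - \<mu> *\<^sub>C x j) (x j))"
      using that by (intro sum.cong) (auto simp: cinner_diff_left cinner_scaleC_left algebra_simps)
    then show ?thesis by (simp add: sum.distrib sum_distrib_left)
  qed
qed

section \<open>The numerical range\<close>

lemma c_numerical_range_upper:
  fixes B :: "'a :: complex_inner \<Rightarrow> 'a"
  assumes B: "clinear B" and sq: "\<And>x. B (B x) = \<delta> *\<^sub>C x" and le: "\<And>x. norm (B x) \<le> t * norm x"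
    and t: "t > 0" "cmod \<delta> < t\<^sup>2" and c: "\<forall>r\<in>set c. r \<noteq> 0" "c \<noteq> []"
    and m: "m = max (card {j. j < length c \<and> c ! j > 0}) (card {j. j < length c \<and> c ! j < 0})"
    and w: "w \<in> c_numerical_range c B"
  shows "\<exists>\<zeta>. w = complex_of_real (\<Sum>j<length c. \<bar>c ! j\<bar>) * ellipse_map \<delta> t \<zeta> \<and> cmod \<zeta> \<le> 1 \<and>
    (cmod \<zeta> = 1 \<longrightarrow>
      (\<exists>L. complex_vector.subspace L \<and> cdim_at_least m L \<and> (\<forall>v\<in>L. norm (B v) = t * norm v)))"
proof -
  let ?C = "\<Sum>j<length c. \<bar>c ! j\<bar>"
  have "0 < \<bar>c ! 0\<bar>" using c by (simp add: nth_mem)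
  also have "\<dots> \<le> ?C" using c(2) by (intro member_le_sum) auto
  finally have C: "?C \<noteq> 0" by simp
  obtain x :: "nat \<Rightarrow> 'a" where x: "orthonormal_on {..<length c} x"
    and wx: "w = (\<Sum>j<length c. complex_of_real (c ! j) * cinner (B (x j)) (x j))"
    using w unfolding c_numerical_range_def orthonormal_on_def by auto
  define \<zeta> where "\<zeta> = ellipse_coord \<delta> t (w / complex_of_real ?C)"
  have wz: "w = complex_of_real ?C * ellipse_map \<delta> t \<zeta>"
    unfolding \<zeta>_def ellipse_map_coord[OF t] using C by (simp del: of_real_sum)
  note bd = c_numerical_range_boundary[OF B sq le t x c wz[unfolded wx]]
  have "\<exists>L. complex_vector.subspace L \<and> cdim_at_least m L \<and> (\<forall>v\<in>L. norm (B v) = t * norm v)"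
    if z: "cmod \<zeta> = 1"
  proof -
    have *: "\<exists>L. complex_vector.subspace L \<and> cdim_at_least (card J) L \<and> (\<forall>v\<in>L. norm (B v) = t * norm v)"
      if J: "J \<subseteq> {..<length c}" "\<And>j. j \<in> J \<Longrightarrow> sgn (c ! j) = r" and r: "\<bar>r\<bar> = 1" for J r
    proof (rule independent_maximal_vectors[OF B sq le t, where l = "complex_of_real r * \<zeta> / complex_of_real t"])
      show "finite J" using J(1) finite_subset by blast
      show "orthonormal_on J x" using x J(1) by (auto simp: orthonormal_on_def subset_iff)
      show "cmod (complex_of_real r * \<zeta> / complex_of_real t) = 1 / t"
        using z r t(1) by (simp add: norm_mult norm_divide)
      show "norm (B (x j - (complex_of_real r * \<zeta> / complex_of_real t) *\<^sub>C B (x j)))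
          = t * norm (x j - (complex_of_real r * \<zeta> / complex_of_real t) *\<^sub>C B (x j))" if "j \<in> J" for j
        using bd(2)[OF z, of j] J that by auto
    qed
    \<comment> \<open>Take the entries of the more frequent sign.\<close>
    from *[of "{j. j < length c \<and> c ! j > 0}" 1] *[of "{j. j < length c \<and> c ! j < 0}" "-1"]
    show ?thesis unfolding m max_def by (auto split: if_splits)
  qed
  then show ?thesis using wz bd(1) by blast
qed

text \<open>
  An interior point of the ellipse for \<open>t\<close> is still in the confocal ellipse for some \<open>r < t\<close>, and
  then in those for the parameters \<open>u i > r\<close> of pairs obtained from the essential norm.
\<close>

lemma c_numerical_range_contains_open_disc:
  fixes B :: "'a :: chilbert_space \<Rightarrow> 'a"
  assumes B: "bounded_clinear B" and sq: "\<And>x. B (B x) = \<sigma>\<^sup>2 *\<^sub>C x"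
    and t: "cmod \<sigma> < t" "t = ess_norm B" and c: "\<forall>r\<in>set c. r \<noteq> 0" and z: "cmod \<zeta> < 1"
  shows "complex_of_real (\<Sum>j<length c. \<bar>c ! j\<bar>) * ellipse_map (\<sigma>\<^sup>2) t \<zeta> \<in> c_numerical_range c B"
proof -
  have lin: "clinear B" using B by (simp add: bounded_clinear_def)
  have t0: "t > 0" using t(1) by (smt (verit) norm_ge_zero)
  define p where "p = ellipse_map (\<sigma>\<^sup>2) t \<zeta>"
  define h where "h r = r + cmod (\<sigma>\<^sup>2) / r" for r
  have "focal_sum \<sigma> p < h t" using focal_sum_ellipse_map(1)[OF t(1)] z by (simp add: p_def h_def)
  moreover have "(h \<longlongrightarrow> h t) (at_left t)" unfolding h_def using t0 by (intro tendsto_intros) auto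
  ultimately have "\<forall>\<^sub>F r in at_left t. focal_sum \<sigma> p < h r" by (simp add: order_tendstoD)
  moreover have "\<forall>\<^sub>F r in at_left t. r \<in> {cmod \<sigma><..<t}" by (rule eventually_at_left_real[OF t(1)])
  ultimately have "\<exists>r. focal_sum \<sigma> p < h r \<and> r \<in> {cmod \<sigma><..<t}"
    by (intro eventually_happens'[OF trivial_limit_at_left_real]) (rule eventually_conj)
  then obtain r where r: "focal_sum \<sigma> p < h r" "cmod \<sigma> < r" "r < t" by auto
  have r0: "r > 0" using r(2) by (smt (verit) norm_ge_zero)
  have r2: "cmod (\<sigma>\<^sup>2) \<le> r\<^sup>2" using r(2) by (simp add: norm_power power_mono)
  obtain m where m: "card {j. j < length c \<and> c ! j > 0} \<le> m" "card {j. j < length c \<and> c ! j < 0} \<le> m"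
    using max.cobounded1 max.cobounded2 by blast
  have "r < ess_norm B" using r(3) t(2) by simp
  from exchanged_pairs_from_ess_norm[OF B sq less_imp_le[OF r0] r2 this, of m]
  obtain x y u where ex: "exchanged_pairs B (\<sigma>\<^sup>2) m x y u" and u: "\<forall>i<m. r < u i" by blast
  have "cmod (ellipse_coord (\<sigma>\<^sup>2) (u i) p) \<le> 1 \<and> ellipse_map (\<sigma>\<^sup>2) (u i) (ellipse_coord (\<sigma>\<^sup>2) (u i) p) = p"
    if i: "i < m" for i
  proof -
    have ui: "r < u i" using u i by blast
    have su: "cmod \<sigma> < u i" using ui r(2) by simp
    then have "(cmod \<sigma>)\<^sup>2 < (u i)\<^sup>2" by (intro power_strict_mono) auto
    then have eq: "ellipse_map (\<sigma>\<^sup>2) (u i) (ellipse_coord (\<sigma>\<^sup>2) (u i) p) = p"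
      using ui r0 by (intro ellipse_map_coord) (auto simp: norm_power)
    have "focal_sum \<sigma> p \<le> u i + cmod (\<sigma>\<^sup>2) / u i"
      using major_axis_mono[OF r0 r2, of "u i"] r(1) ui by (simp add: h_def)
    then show ?thesis using focal_sum_ellipse_map(2)[OF su, of "ellipse_coord (\<sigma>\<^sup>2) (u i) p"] eq by simp
  qed
  then show ?thesis unfolding p_def[symmetric]
    by (intro c_numerical_range_exchanged_pairs[OF lin ex _ _ c m]) auto
qed

lemma c_numerical_range_if_critical:
  fixes B :: "'a :: complex_inner \<Rightarrow> 'a"
  assumes inf: "infinite_cdim (UNIV :: 'a set)" and B: "clinear B" and sq: "\<And>x. B (B x) = \<sigma>\<^sup>2 *\<^sub>C x"
    and le: "\<And>x. norm (B x) \<le> t * norm x" and t: "cmod \<sigma> = t"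
    and eig: "infinite_cdim (eigenspace B \<sigma>)" "infinite_cdim (eigenspace B (- \<sigma>))"
    and c: "\<forall>r\<in>set c. r \<noteq> 0"
  shows "c_numerical_range c B
    = (\<lambda>q. complex_of_real (q * (\<Sum>j<length c. \<bar>c ! j\<bar>)) * \<sigma>) ` {-1..1}"
proof
  let ?C = "\<Sum>j<length c. \<bar>c ! j\<bar>"
  show "c_numerical_range c B \<subseteq> (\<lambda>q. complex_of_real (q * ?C) * \<sigma>) ` {-1..1}"
  proof
    fix w assume "w \<in> c_numerical_range c B"
    then obtain x :: "nat \<Rightarrow> 'a" where x: "orthonormal_on {..<length c} x"
      and wx: "w = (\<Sum>j<length c. complex_of_real (c ! j) * cinner (B (x j)) (x j))"
      unfolding c_numerical_range_def orthonormal_on_def by auto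
    have "\<forall>j. \<exists>q. j < length c \<longrightarrow> \<bar>q\<bar> \<le> 1 \<and> cinner (B (x j)) (x j) = complex_of_real q * \<sigma>"
      using rayleigh_value_if_critical[OF B sq le t] orthonormal_on_norm[OF x] by blast
    then obtain q where q: "\<And>j. j < length c \<Longrightarrow> \<bar>q j\<bar> \<le> 1"
      "\<And>j. j < length c \<Longrightarrow> cinner (B (x j)) (x j) = complex_of_real (q j) * \<sigma>" by metis
    let ?S = "\<Sum>j<length c. c ! j * q j"
    have "w = (\<Sum>j<length c. complex_of_real (c ! j * q j) * \<sigma>)"
      unfolding wx by (intro sum.cong) (auto simp: q(2))
    then have w: "w = complex_of_real ?S * \<sigma>" by (simp add: sum_distrib_right)
    have S: "\<bar>?S\<bar> \<le> ?C"
      using q(1) by (intro order_trans[OF sum_abs] sum_mono) (simp add: abs_mult mult_left_le)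
    show "w \<in> (\<lambda>q. complex_of_real (q * ?C) * \<sigma>) ` {-1..1}"
    proof (cases "?C = 0")
      case True
      then show ?thesis using S w by (intro image_eqI[of _ _ 0]) auto
    next
      case False
      then have "?C > 0" by (smt (verit) S)
      then show ?thesis using S w by (intro image_eqI[of _ _ "?S / ?C"]) (auto simp: abs_le_iff field_simps)
    qed
  qed
  show "(\<lambda>q. complex_of_real (q * ?C) * \<sigma>) ` {-1..1} \<subseteq> c_numerical_range c B"
  proof
    fix w assume "w \<in> (\<lambda>q. complex_of_real (q * ?C) * \<sigma>) ` {-1..1}"
    then obtain q where "q \<in> {-1..1}" "w = complex_of_real (q * ?C) * \<sigma>" by blast
    then have q: "\<bar>q\<bar> \<le> 1" "w = complex_of_real ?C * (complex_of_real q * \<sigma>)"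
      by (auto simp: ac_simps)
    obtain m where m: "card {j. j < length c \<and> c ! j > 0} \<le> m" "card {j. j < length c \<and> c ! j < 0} \<le> m"
      using max.cobounded1 max.cobounded2 by blast
    show "w \<in> c_numerical_range c B"
    proof (cases "t = 0")
      case True
      then have "B x = 0" for x using le[of x] by simp
      then obtain x y where ex: "exchanged_pairs B 0 m x y (\<lambda>_. 0)" using exchanged_pairs_zero[OF inf] by blast
      have "complex_of_real ?C * 0 \<in> c_numerical_range c B"
        by (rule c_numerical_range_exchanged_pairs[OF B ex _ _ c m, of "\<lambda>_. 0"]) (auto simp: ellipse_map_def)
      then show ?thesis using q(2) True t by simp
    next
      case False
      then have t0: "t > 0" using t by auto
      obtain x y where ex: "exchanged_pairs B (\<sigma>\<^sup>2) m x y (\<lambda>_. t)"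
        using exchanged_pairs_if_critical[OF B sq le t0 t eig] by blast
      \<comment> \<open>As \<open>\<bar>\<sigma>\<bar> = t\<close>, both summands of the ellipse map at this point are equal to \<open>q \<sigma>\<close>.\<close>
      define \<zeta> where "\<zeta> = complex_of_real q * cnj \<sigma> / complex_of_real t"
      have "cmod \<zeta> \<le> 1" using q(1) t t0 by (simp add: \<zeta>_def norm_mult norm_divide)
      moreover have "ellipse_map (\<sigma>\<^sup>2) t \<zeta> = complex_of_real q * \<sigma>"
      proof -
        have "\<sigma> * cnj \<sigma> = complex_of_real (t\<^sup>2)" using complex_norm_square[of \<sigma>] t by simp
        then have "\<sigma>\<^sup>2 / complex_of_real t * \<zeta> = complex_of_real q * \<sigma>"
          using t0 by (simp add: \<zeta>_def power2_eq_square field_simps)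
        then show ?thesis using t0 by (simp add: ellipse_map_def \<zeta>_def)
      qed
      ultimately show ?thesis unfolding q(2)
        by (intro c_numerical_range_exchanged_pairs[OF B ex _ _ c m, of "\<lambda>_. \<zeta>"]) auto
    qed
  qed
qed

theorem theorem2p5:
  fixes A :: "'a :: chilbert_space \<Rightarrow> 'a"
    and \<mu> \<nu> f g :: complex
    and s C major minor :: real
    and c :: "real list"
    and m_pos m_neg m :: nat
  assumes "infinite_cdim (UNIV :: 'a set)"
    and "bounded_clinear A"
    and "\<forall>x. A (A x) - (2 * \<mu>) *\<^sub>C A x - \<nu> *\<^sub>C x = 0"
    and "infinite_cdim (eigenspace A (\<mu> + csqrt (\<mu>\<^sup>2 + \<nu>)))"
    and "infinite_cdim (eigenspace A (\<mu> - csqrt (\<mu>\<^sup>2 + \<nu>)))"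
    and "s = onorm (\<lambda>x. A x - \<mu> *\<^sub>C x)"
    and "s = ess_norm (\<lambda>x. A x - \<mu> *\<^sub>C x)"
    and "c \<noteq> []" and "\<forall>t\<in>set c. t \<noteq> 0"
    and "C = (\<Sum>j<length c. \<bar>c ! j\<bar>)"
    and "m_pos = card {j. j < length c \<and> c ! j > 0}"
    and "m_neg = card {j. j < length c \<and> c ! j < 0}"
    and "m = max m_pos m_neg"
    and "f = \<mu> * complex_of_real (\<Sum>j<length c. c ! j) + csqrt (\<mu>\<^sup>2 + \<nu>) * complex_of_real C"
    and "g = \<mu> * complex_of_real (\<Sum>j<length c. c ! j) - csqrt (\<mu>\<^sup>2 + \<nu>) * complex_of_real C"
    and "major = (s + cmod (\<mu>\<^sup>2 + \<nu>) * inverse s) * C"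
    and "minor = (s - cmod (\<mu>\<^sup>2 + \<nu>) * inverse s) * C"
  shows "ellipse_data f g major minor \<and>
    c_numerical_range c A =
      (if \<exists>L. complex_vector.subspace L \<and> cdim_at_least m L \<and>
              norm_attained_on (\<lambda>x. A x - \<mu> *\<^sub>C x) L
       then closed_elliptical_disc f g major minor
       else open_elliptical_disc f g major minor)"
proof -
  define \<sigma> where "\<sigma> = csqrt (\<mu>\<^sup>2 + \<nu>)"
  have s2: "\<mu>\<^sup>2 + \<nu> = \<sigma>\<^sup>2" by (simp add: \<sigma>_def)
  define B where "B x = A x - \<mu> *\<^sub>C x" for x
  have B_eq: "(\<lambda>x. A x - \<mu> *\<^sub>C x) = B" by (simp add: B_def fun_eq_iff)
  have A: "clinear A" "bounded_linear A" using assms(2) by (auto simp: bounded_clinear_def)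
  have "bounded_linear (\<lambda>x :: 'a. \<mu> *\<^sub>C x)"
    by (rule bounded_linear_intro[where K = "cmod \<mu>"])
      (auto simp: scaleC_add_right scaleR_scaleC scaleC_scaleC norm_scaleC mult.commute)
  then have Bl: "bounded_linear B" unfolding B_eq[symmetric] by (rule bounded_linear_sub[OF A(2)])
  have B: "clinear B"
    by (rule clinearI) (auto simp: B_def clinear_add[OF A(1)] clinear_scaleC[OF A(1)] scaleC_add_right
        complex_vector.scale_right_diff_distrib scaleC_scaleC mult.commute)
  have Bb: "bounded_clinear B" using B Bl by (simp add: bounded_clinear_def)
  have sq: "B (B x) = \<sigma>\<^sup>2 *\<^sub>C x" for x
  proof -
    have "A (A x) = (2 * \<mu>) *\<^sub>C A x + \<nu> *\<^sub>C x" using assms(3) by (simp add: algebra_simps)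
    then have "B (B x) = (2 * \<mu>) *\<^sub>C A x + \<nu> *\<^sub>C x - \<mu> *\<^sub>C A x - \<mu> *\<^sub>C A x + (\<mu> * \<mu>) *\<^sub>C x"
      by (simp add: B_def clinear_diff[OF A(1)] clinear_scaleC[OF A(1)]
          complex_vector.scale_right_diff_distrib scaleC_scaleC algebra_simps)
    also have "(2 * \<mu>) *\<^sub>C A x = \<mu> *\<^sub>C A x + \<mu> *\<^sub>C A x"
      by (simp only: mult_2 scaleC_add_left)
    also have "\<mu> *\<^sub>C A x + \<mu> *\<^sub>C A x + \<nu> *\<^sub>C x - \<mu> *\<^sub>C A x - \<mu> *\<^sub>C A x + (\<mu> * \<mu>) *\<^sub>C x
        = (\<mu>\<^sup>2 + \<nu>) *\<^sub>C x"
      by (simp add: power2_eq_square scaleC_add_left)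
    finally show ?thesis by (simp only: s2)
  qed
  have s_onorm: "s = onorm B" and s_ess: "s = ess_norm B" using assms(6,7) by (simp_all only: B_eq)
  have le: "norm (B x) \<le> s * norm x" for x unfolding s_onorm by (rule onorm[OF Bl])
  have s0: "s \<ge> 0" unfolding s_onorm by (rule onorm_pos_le[OF Bl])
  have sig_le: "cmod \<sigma> \<le> s"
  proof -
    obtain x :: 'a where x: "x \<noteq> 0"
      using assms(1) unfolding infinite_cdim_def
      by (metis complex_vector.span_zero finite.emptyI subsetI)
    have "(cmod \<sigma>)\<^sup>2 * norm x = norm (B (B x))" by (simp add: sq norm_scaleC norm_power)
    also have "\<dots> \<le> s * norm (B x)" by (rule le)
    also have "\<dots> \<le> s * (s * norm x)" by (rule mult_left_mono[OF le s0])
    finally have "(cmod \<sigma>)\<^sup>2 * norm x \<le> s\<^sup>2 * norm x" by (simp add: power2_eq_square)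
    then have "(cmod \<sigma>)\<^sup>2 \<le> s\<^sup>2" using x by simp
    then show ?thesis using s0 by (rule power2_le_imp_le)
  qed
  have "0 < \<bar>c ! 0\<bar>" using assms(8,9) by (simp add: nth_mem)
  also have "\<dots> \<le> C" unfolding assms(10) using assms(8) by (intro member_le_sum) auto
  finally have C: "C > 0" .
  define M where "M = \<mu> * complex_of_real (\<Sum>j<length c. c ! j)"
  have f: "f = M + \<sigma> * complex_of_real C" and g: "g = M - \<sigma> * complex_of_real C"
    using assms(14,15) by (simp_all add: M_def \<sigma>_def)
  have major: "major = (s + cmod (\<sigma>\<^sup>2) / s) * C" and minor: "minor = (s - cmod (\<sigma>\<^sup>2) / s) * C"
    using assms(16,17) by (simp_all add: s2 divide_inverse)
  have W: "c_numerical_range c A = (\<lambda>z. M + z) ` c_numerical_range c B"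
    unfolding c_numerical_range_translate[of c A \<mu>] B_eq M_def ..
  have small: "cmod (\<sigma>\<^sup>2) / s \<le> s"
    using sig_le s0 by (cases "s = 0") (auto simp: divide_le_eq norm_power power_mono simp flip: power2_eq_square)
  have data: "ellipse_data f g major minor"
  proof -
    have "f - g = complex_of_real (2 * C) * \<sigma>" by (simp add: f g)
    then have "dist f g = 2 * C * cmod \<sigma>" using C by (simp add: dist_norm norm_mult)
    moreover have "((s + k) * C)\<^sup>2 = ((s - k) * C)\<^sup>2 + 4 * C\<^sup>2 * (s * k)" for k
      by (simp add: power2_eq_square algebra_simps)
    moreover have "s * (cmod (\<sigma>\<^sup>2) / s) = (cmod \<sigma>)\<^sup>2"
      using sig_le by (cases "s = 0") (auto simp: norm_power)
    ultimately have "major\<^sup>2 = minor\<^sup>2 + (dist f g)\<^sup>2"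
      by (simp only: major minor) (simp add: power_mult_distrib)
    then show ?thesis using small s0 C by (auto simp: ellipse_data_def major minor)
  qed
  define att where "att \<longleftrightarrow>
    (\<exists>L. complex_vector.subspace L \<and> cdim_at_least m L \<and> norm_attained_on B L)"
  have att: "att \<longleftrightarrow> (\<exists>L. complex_vector.subspace L \<and> cdim_at_least m L \<and> (\<forall>v\<in>L. norm (B v) = s * norm v))"
    by (simp add: att_def norm_attained_on_def s_onorm)
  have "c_numerical_range c A = (if att then closed_elliptical_disc f g major minor
      else open_elliptical_disc f g major minor)"
  proof (cases "cmod \<sigma> = s")
    case True
    have "norm (B v) = s * norm v" for v
      using maximal_everywhere_if_critical[OF sq le s0] True by (simp add: norm_power)
    then have att unfolding att
      using assms(1) by (intro exI[of _ UNIV]) (auto simp: cdim_at_least_def)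
    have "minor = 0" unfolding minor using True by (cases "s = 0") (auto simp: norm_power power2_eq_square norm_mult)
    have eig: "eigenspace B l = eigenspace A (\<mu> + l)" for l
      by (auto simp: eigenspace_def B_def scaleC_add_left algebra_simps)
    have "infinite_cdim (eigenspace B \<sigma>)" "infinite_cdim (eigenspace B (- \<sigma>))"
      using assms(4,5) unfolding eig by (simp_all add: \<sigma>_def)
    then have "c_numerical_range c B = (\<lambda>q. complex_of_real (q * C) * \<sigma>) ` {-1..1}"
      unfolding assms(10) using c_numerical_range_if_critical[OF assms(1) B sq le True] assms(9) by blast
    then have "c_numerical_range c A = (\<lambda>q. M + complex_of_real (q * C) * \<sigma>) ` {-1..1}"
      unfolding W by (simp add: image_image)
    also have "\<dots> = closed_segment f g"
    proof -
      have "M + complex_of_real ((1 - 2 * u) * C) * \<sigma> = (1 - u) *\<^sub>R f + u *\<^sub>R g" for u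
        by (simp add: f g scaleR_conv_of_real algebra_simps)
      then have "closed_segment f g = (\<lambda>u. M + complex_of_real ((1 - 2 * u) * C) * \<sigma>) ` {0..1}"
        by (simp add: closed_segment_image_interval)
      also have "\<dots> = (\<lambda>q. M + complex_of_real (q * C) * \<sigma>) ` ((\<lambda>u. 1 - 2 * u) ` {0..1})"
        by (simp only: image_image)
      also have "(\<lambda>u :: real. 1 - 2 * u) ` {0..1} = {-1..1}"
      proof
        show "{-1..1} \<subseteq> (\<lambda>u :: real. 1 - 2 * u) ` {0..1}"
          by (intro subsetI, rule_tac x = "(1 - x) / 2" in image_eqI) (auto simp: field_simps)
      qed auto
      finally show ?thesis ..
    qed
    finally show ?thesis using \<open>att\<close> \<open>minor = 0\<close> by (simp add: closed_elliptical_disc_def)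
  next
    case False
    then have sig: "cmod \<sigma> < s" using sig_le by simp
    then have sp: "s > 0" by (smt (verit) norm_ge_zero)
    have "(cmod \<sigma>)\<^sup>2 < s\<^sup>2" using sig by (intro power_strict_mono) auto
    then have d: "cmod (\<sigma>\<^sup>2) < s\<^sup>2" by (simp add: norm_power)
    then have "minor \<noteq> 0" using C sp unfolding minor by (simp add: field_simps power2_eq_square)
    have foci: "dist (M + complex_of_real C * p) f + dist (M + complex_of_real C * p) g = C * focal_sum \<sigma> p" for p
    proof -
      have "M + complex_of_real C * p - f = complex_of_real C * (p - \<sigma>)"
        "M + complex_of_real C * p - g = complex_of_real C * (p + \<sigma>)"
        by (simp_all add: f g algebra_simps)
      then show ?thesis using C
        by (simp only: dist_norm norm_mult norm_of_real focal_sum_def) (simp add: algebra_simps)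
    qed
    \<comment> \<open>\<open>P\<close> parametrises the plane so that the ellipse is the image of the unit circle.\<close>
    define P where "P \<zeta> = M + complex_of_real C * ellipse_map (\<sigma>\<^sup>2) s \<zeta>" for \<zeta>
    have P_lt: "dist (P \<zeta>) f + dist (P \<zeta>) g < major \<longleftrightarrow> cmod \<zeta> < 1"
      and P_le: "dist (P \<zeta>) f + dist (P \<zeta>) g \<le> major \<longleftrightarrow> cmod \<zeta> \<le> 1" for \<zeta>
      using C unfolding P_def foci major mult.commute[of _ C]
      by (simp_all only: mult_less_cancel_left_pos mult_le_cancel_left_pos focal_sum_ellipse_map[OF sig])
    have P_surj: "\<exists>\<zeta>. z = P \<zeta>" for z
      using C ellipse_map_coord[OF sp d, of "(z - M) / complex_of_real C"]
      by (intro exI[of _ "ellipse_coord (\<sigma>\<^sup>2) s ((z - M) / complex_of_real C)"]) (simp add: P_def)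
    have upper: "\<exists>\<zeta>. z = P \<zeta> \<and> cmod \<zeta> \<le> 1 \<and> (cmod \<zeta> = 1 \<longrightarrow> att)" if "z \<in> c_numerical_range c A" for z
    proof -
      from that obtain w where w: "w \<in> c_numerical_range c B" "z = M + w" unfolding W by blast
      from c_numerical_range_upper[OF B sq le sp d assms(9,8) assms(13)[unfolded assms(11,12)] w(1)]
      show ?thesis unfolding w(2) P_def att assms(10) by blast
    qed
    show ?thesis
    proof (cases att)
      case True
      then obtain L where L: "complex_vector.subspace L" "cdim_at_least m L"
        "\<And>v. v \<in> L \<Longrightarrow> norm (B v) = s * norm v" unfolding att by blast
      obtain x y where ex: "exchanged_pairs B (\<sigma>\<^sup>2) m x y (\<lambda>_. s)"
        using exchanged_pairs_from_maximal_subspace[OF B sq le sp d L] by blast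
      have "P \<zeta> \<in> c_numerical_range c A" if "cmod \<zeta> \<le> 1" for \<zeta>
        unfolding W P_def assms(10) using that assms(9,11-13)
        by (intro imageI c_numerical_range_exchanged_pairs[OF B ex, of "\<lambda>_. \<zeta>"]) auto
      then have "z \<in> c_numerical_range c A \<longleftrightarrow> dist z f + dist z g \<le> major" for z
        using upper[of z] P_surj[of z] P_le by metis
      then have "c_numerical_range c A = {z. dist z f + dist z g \<le> major}" by blast
      then show ?thesis using True \<open>minor \<noteq> 0\<close> by (simp add: closed_elliptical_disc_def)
    next
      case False
      have "P \<zeta> \<in> c_numerical_range c A" if "cmod \<zeta> < 1" for \<zeta>
        unfolding W P_def assms(10)
        by (intro imageI c_numerical_range_contains_open_disc[OF Bb sq sig s_ess assms(9) that])
      moreover have "\<exists>\<zeta>. z = P \<zeta> \<and> cmod \<zeta> < 1" if "z \<in> c_numerical_range c A" for z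
        using upper[OF that] False by (metis order_less_le)
      ultimately have "z \<in> c_numerical_range c A \<longleftrightarrow> dist z f + dist z g < major" for z
        using P_surj[of z] P_lt by metis
      then have "c_numerical_range c A = {z. dist z f + dist z g < major}" by blast
      then show ?thesis using False \<open>minor \<noteq> 0\<close> by (simp add: open_elliptical_disc_def)
    qed
  qed
  then show ?thesis using data unfolding att_def B_eq by blast
qed

end
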